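(* Let $\lambda=\gamma=\frac{1+\sqrt5}2$. For $z\in[0,1)^2$ the minimal period length $\pi(z)$ of $(T^k(z))_{k\in\mathbb Z}$ is as follows: \begin{itemize} \item $\pi(z)=1$ if $z=(0,0)$ or $z=\left(\frac{\gamma^2}{\gamma^2+1},\frac{\gamma^2}{\gamma^2+1}\right)$; \item $\pi(z)=5$ if $z\in\mathcal R\setminus\left\{(0,0),\left(\frac{\gamma^2}{\gamma^2+1},\frac{\gamma^2}{\gamma^2+1}\right)\right\}$; \item $\pi(z)=(5\cdot4^n+1)/3$ if $S^n(z)=T^m\left(\frac{1/\gamma}{\gamma^2+1},\frac2{\gamma^2+1}\right)$ for some $n\ge0$, $m\in\{0,1\}$; \item $\pi(z)=5(5\cdot4^n+1)/3$ if $S^n(z)\in T^m\left(D_\alpha\setminus\left\{\left(\frac{1/\gamma}{\gamma^2+1},\frac2{\gamma^2+1}\right)\right\}\right)$ for some $n\ge0$, $m\in\{0,1\}$; \item $\pi(z)=(10\cdot4^n-1)/3$ if $S^n(z)=T^m\left(\frac1{\gamma^2+1},\frac1{\gamma^2+1}\right)$ for some $n\ge0$, $m\in\{0,1,2\}$; \item $\pi(z)=5(10\cdot4^n-1)/3$ if $S^n(z)\in T^m\left(D_\beta\setminus\left\{\left(\frac1{\gamma^2+1},\frac1{\gamma^2+1}\right)\right\}\right)$ for some $n\ge0$, $m\in\{0,1,2\}$; \item $\pi(z)=\infty$ if $S^n(z)\in\mathcal D\setminus\mathcal P$ for all $n\ge0$. \end{itemize} Moreover, if $(a_k)_{k\in\mathbb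 Z}$ is an integer sequence with $0\le a_{k-1}+\gamma a_k+a_{k+1}<1$ for all $k\in\mathbb Z$, then its minimal period length is $\pi(\{\gamma a_{k-1}\},\{\gamma a_k\})$ (which does not depend on $k$).
   Context: Here $\{u\}=u-\lfloor u\rfloor$ denotes the fractional part of a real number $u$ (where braces enclose a real number). $T:[0,1)^2\to[0,1)^2$ is the bijection $T(x,y)=(y,\{-x+y/\gamma\})$. $\pi(z)$ is the least $p\ge1$ with $T^p(z)=z$, and $\pi(z)=\infty$ if no such $p$ exists. Put $\mathcal R=\{(x,y)\in[0,1)^2:\ y<\gamma x,\ x+y>1,\ x<\gamma y\}\cup\{(0,0)\}$ and $\mathcal D=[0,1)^2\setminus\mathcal R$. Write $\mathcal D/\gamma^2=\{z/\gamma^2:z\in\mathcal D\}$. Let $\mathcal P$ be the set of points of $\mathcal D$ which are not eventually mapped to $\mathcal D/\gamma^2$, i.e. of $z\in\mathcal D$ with $T^m(z)\notin\mathcal D/\gamma^2$ for all $m\ge0$; explicitly $\mathcal P=D_\alpha\cup T(D_\alpha)\cup D_\beta\cup T(D_\beta)\cup T^2(D_\beta)$, where $D_\alpha=\{(x,y)\in[0,1)^2\setminus\{(0,0)\}:\ y\ge\gamma x,\ y\ge1/\gamma^2,\ x+y\le1,\ y\le(1+x)/\gamma\}$ and $D_\beta=\{z/\gamma^2:z\in\mathcal R\setminus\{(0,0)\}\}$. For $z\in\mathcal D\setminus\mathcal P$ let $s(z)=\min\{m\ge0:T^m(z)\in\mathcal D/\gamma^2\}$, and define $S:\mathcal D\setminus\mathcal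 P\to\mathcal D$, $S(z)=\gamma^2T^{s(z)}(z)$. For $z\in\mathcal D$, $S^0(z)=z$ and $S^n(z)=S(S^{n-1}(z))$ is defined as long as $S^{n-1}(z)$ is defined and lies in $\mathcal D\setminus\mathcal P$; any condition on $S^n(z)$ includes that $z\in\mathcal D$ and $S^n(z)$ is defined. *)

theory Defs
  imports "HOL-Analysis.Analysis" "HOL-Library.Extended_Nat"
begin

definition golden :: real where
  "golden = (1 + sqrt 5) / 2"

definition unit_square :: "(real \<times> real) set" where
  "unit_square = {0..<1} \<times> {0..<1}"

text \<open>The map is total on the plane; it is only of interest on the unit square, which it
  maps to itself.\<close>

definition T_map :: "real \<times> real \<Rightarrow> real \<times> real" where
  "T_map = (\<lambda>(x, y). (y, frac (- x + y / golden)))"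

text \<open>Periods take values in the extended naturals; the infimum of the empty set is \<open>\<infinity>\<close>.\<close>

definition T_period :: "real \<times> real \<Rightarrow> enat" where
  "T_period z = (INF p \<in> {p. p \<ge> 1 \<and> (T_map ^^ p) z = z}. enat p)"

definition seq_period :: "(int \<Rightarrow> int) \<Rightarrow> enat" where
  "seq_period a = (INF p \<in> {p. p \<ge> 1 \<and> (\<forall>k. a (k + int p) = a k)}. enat p)"

definition R_set :: "(real \<times> real) set" where
  "R_set = {(x, y) \<in> unit_square. y < golden * x \<and> x + y > 1 \<and> x < golden * y} \<union> {(0, 0)}"

definition D_set :: "(real \<times> real) set" where
  "D_set = unit_square - R_set"

definition D_small :: "(real \<times> real) set" where
  "D_small = (\<lambda>z. z /\<^sub>R golden\<^sup>2) ` D_set"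

definition P_set :: "(real \<times> real) set" where
  "P_set = {z \<in> D_set. \<forall>m. (T_map ^^ m) z \<notin> D_small}"

definition D_alpha :: "(real \<times> real) set" where
  "D_alpha = {(x, y) \<in> unit_square - {(0, 0)}.
     y \<ge> golden * x \<and> y \<ge> 1 / golden\<^sup>2 \<and> x + y \<le> 1 \<and> y \<le> (1 + x) / golden}"

definition D_beta :: "(real \<times> real) set" where
  "D_beta = (\<lambda>z. z /\<^sub>R golden\<^sup>2) ` (R_set - {(0, 0)})"

definition z_R :: "real \<times> real" where
  "z_R = (golden\<^sup>2 / (golden\<^sup>2 + 1), golden\<^sup>2 / (golden\<^sup>2 + 1))"

definition z_alpha :: "real \<times> real" where
  "z_alpha = ((1 / golden) / (golden\<^sup>2 + 1), 2 / (golden\<^sup>2 + 1))"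

definition z_beta :: "real \<times> real" where
  "z_beta = (1 / (golden\<^sup>2 + 1), 1 / (golden\<^sup>2 + 1))"

definition hit_time :: "real \<times> real \<Rightarrow> nat" where
  "hit_time z = (LEAST m. (T_map ^^ m) z \<in> D_small)"

text \<open>\<open>S_map\<close> is only meaningful on \<open>D_set - P_set\<close>; its iterates as a partial map are given
  by \<open>S_iter\<close>, where \<open>None\<close> means undefined.\<close>

definition S_map :: "real \<times> real \<Rightarrow> real \<times> real" where
  "S_map z = golden\<^sup>2 *\<^sub>R (T_map ^^ hit_time z) z"

primrec S_iter :: "nat \<Rightarrow> real \<times> real \<Rightarrow> (real \<times> real) option" where
  "S_iter 0 z = (if z \<in> D_set then Some z else None)"
| "S_iter (Suc n) z =
     (case S_iter n z of
        None \<Rightarrow> None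
      | Some w \<Rightarrow> if w \<in> D_set - P_set then Some (S_map w) else None)"

definition S_iter_in :: "nat \<Rightarrow> real \<times> real \<Rightarrow> (real \<times> real) set \<Rightarrow> bool" where
  "S_iter_in n z A \<longleftrightarrow> (\<exists>w \<in> A. S_iter n z = Some w)"

end

theory Submission
  imports Defs
begin

text \<open>The linear part of \<open>T\<close> is the matrix with rows \<open>(0, 1)\<close> and \<open>(-1, 1/\<gamma>)\<close>. It has determinant \<open>1\<close>
  and trace \<open>1/\<gamma> = 2 cos (2\<pi>/5)\<close>, so it has order five, and \<open>T\<close> is this linear map followed by adding
  a digit \<open>0\<close> or \<open>1\<close> to the second coordinate. On \<open>\<R>\<close> without the origin the digit is always \<open>1\<close>, so
  that \<open>T\<close> turns \<open>\<R>\<close> with order five about the fixed point \<open>z_R\<close>.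

  Everything else rests on the self-similarity of \<open>T\<close> on \<open>\<D>\<close>. Let \<open>w\<close> be a point of \<open>\<D>\<close> with digit
  \<open>d\<close>. Then the orbit of \<open>w/\<gamma>\<^sup>2\<close> returns to \<open>\<D>/\<gamma>\<^sup>2\<close> for the first time after \<open>1 + 5d\<close> steps, at the
  point \<open>T(w)/\<gamma>\<^sup>2\<close>; on the way it shows the digits \<open>0\<close> if \<open>d = 0\<close>, and \<open>1,0,1,1,0,1\<close> if \<open>d = 1\<close>
  (lemma \<open>return_block\<close>). Hence the first return map to \<open>\<D>/\<gamma>\<^sup>2\<close> is a scaled copy of \<open>T\<close>, and if \<open>w\<close>
  has minimal period \<open>p\<close> with \<open>c\<close> digits \<open>1\<close> in a period, then \<open>w/\<gamma>\<^sup>2\<close> has minimal period \<open>p + 5c\<close>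
  with \<open>4c\<close> digits \<open>1\<close> (lemma \<open>cycle_shrink\<close>). As \<open>S(z)/\<gamma>\<^sup>2\<close> lies on the orbit of \<open>z\<close>, the same change
  of \<open>(p, c)\<close> leads from \<open>S(z)\<close> to \<open>z\<close>, and \<open>n\<close> applications of \<open>S\<close> give
  \<open>p + 5c(4\<^sup>n - 1)/3\<close> (lemma \<open>cycle_S_iter\<close>).

  The iteration of \<open>S\<close> stops at the points of \<open>\<D>\<close> that never reach \<open>\<D>/\<gamma>\<^sup>2\<close>. An explicit polygon
  decomposition of \<open>\<D>\<close> shows that these lie on the orbits of the pentagons \<open>D\<^sub>\<alpha>\<close> and \<open>D\<^sub>\<beta>\<close>
  (lemma \<open>P_set_cases\<close>). There \<open>T\<^sup>2\<close>, respectively \<open>T\<^sup>3\<close>, is a rotation of order five, so \<open>(p, c)\<close> is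
  \<open>(2, 1)\<close> or \<open>(3, 2)\<close> at the centres and five times that elsewhere. If the iteration never stops, the
  orbit is infinite: each application of \<open>S\<close> would lower a finite period by \<open>5c > 0\<close>, since two
  consecutive digits of a point of \<open>\<D>\<close> are never both \<open>0\<close>.

  For an integer sequence \<open>a\<close> as in the last part, the points \<open>({\<gamma>a\<^bsub>k-1\<^esub>}, {\<gamma>a\<^sub>k})\<close> form an orbit of
  \<open>T\<close>, and by the irrationality of \<open>\<gamma>\<close> such a point determines the sequence.\<close>

notation golden ("\<gamma>")

section \<open>Arithmetic of the golden ratio\<close>

lemma golden_square: "\<gamma> * \<gamma> = \<gamma> + 1"
  by (simp add: golden_def field_simps)

lemma golden_bounds: "8 / 5 < \<gamma>" "\<gamma> < 13 / 8"
proof -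
  have "(11 / 5)\<^sup>2 < (5::real)" "(5::real) < (9 / 4)\<^sup>2"
    by (simp_all add: power2_eq_square)
  then have "11 / 5 < sqrt 5" "sqrt 5 < 9 / 4"
    by (auto intro!: real_less_rsqrt real_less_lsqrt simp del: power_divide less_divide_eq_numeral1 divide_less_eq_numeral1)
  then show "8 / 5 < \<gamma>" "\<gamma> < 13 / 8"
    by (simp_all add: golden_def)
qed

text \<open>With \<open>\<gamma>\<^sup>2 = \<gamma> + 1\<close> as a rewrite rule, every expression that is linear in \<open>x, y\<close> over \<open>\<int>[\<gamma>]\<close> becomes
  a rational combination of \<open>1, \<gamma>, x, \<gamma>x, y, \<gamma>y\<close>. Linear arithmetic treats these as independent
  unknowns; therefore many proofs below supply an inequality together with its multiples by
  positive elements of \<open>\<int>[\<gamma>]\<close> such as \<open>\<gamma>\<close>, \<open>\<gamma> - 1 = 1/\<gamma>\<close> and \<open>2 - \<gamma> = 1/\<gamma>\<^sup>2\<close>.\<close>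

lemma golden_reduce: "\<gamma> * (\<gamma> * a) = \<gamma> * a + a"
  using golden_square by (metis distrib_right mult.assoc mult_1)

lemma golden_inverse: "1 / \<gamma> = \<gamma> - 1" "1 / \<gamma>\<^sup>2 = 2 - \<gamma>"
  using golden_square golden_bounds
  by (simp_all add: field_simps power2_eq_square)

lemma golden_nonzero [simp]: "\<gamma> \<noteq> 0"
  using golden_bounds by simp

lemma golden_mult_mono: "a \<le> b \<Longrightarrow> \<gamma> * a \<le> \<gamma> * b"
  and golden_mult_strict_mono: "a < b \<Longrightarrow> \<gamma> * a < \<gamma> * b"
  using golden_bounds by simp_all

lemmas golden_simps = golden_square golden_reduce algebra_simps

lemma golden_irrational:
  assumes "\<gamma> * of_int n = of_int m"
  shows "n = 0"
proof (rule ccontr)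
  assume "n \<noteq> 0"
  then obtain a b g where g: "g \<noteq> 0" and ab: "coprime a b" "m = a * g" "n = b * g"
    using gcd_coprime_exists[of m n] by (metis gcd_eq_0_iff)
  have "\<gamma> * of_int b = of_int a"
    using assms g by (simp add: ab)
  then have "of_int a * of_int a = (of_int b * of_int a + of_int b * of_int b :: real)"
    by (metis (no_types, opaque_lifting) golden_square distrib_right mult.assoc mult.commute mult_1)
  \<comment> \<open>for a reduced fraction \<open>a/b = \<gamma>\<close> the denominator divides \<open>a\<^sup>2\<close>, hence is a unit\<close>
  then have eq: "a * a = b * (a + b)"
    by (metis (mono_tags, lifting) of_int_add of_int_eq_iff of_int_mult ring_class.ring_distribs(1))
  then have "is_unit b"
    by (metis ab(1) coprime_absorb_right coprime_mult_right_iff dvd_triv_left coprime_commute)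
  then have "b = 1 \<or> b = - 1" by auto
  then have "a * (a - b) = 1" using eq by (auto simp: algebra_simps)
  then have "a = a - b" by (metis zmult_eq_1_iff)
  then show False using \<open>n \<noteq> 0\<close> ab by simp
qed

section \<open>The digits of an orbit\<close>

text \<open>The digit is the integer that \<open>T\<close> adds in order to bring the second coordinate back into the unit
  interval.\<close>

definition digit :: "real \<times> real \<Rightarrow> nat" where
  "digit z = (if snd z < \<gamma> * fst z then 1 else 0)"

lemma T_map_digit:
  assumes "(x, y) \<in> unit_square"
  shows "T_map (x, y) = (y, (\<gamma> - 1) * y - x + real (digit (x, y)))"
proof -
  have xy: "0 \<le> x" "x < 1" "0 \<le> y" "y < 1"
    using assms by (auto simp: unit_square_def)
  have eq: "- x + y / \<gamma> = (\<gamma> - 1) * y - x"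
    using golden_inverse(1) by (metis add.commute diff_conv_add_uminus mult.commute mult_1 times_divide_eq_right)
  have up: "(\<gamma> - 1) * y < \<gamma> - 1" "0 \<le> (\<gamma> - 1) * y"
    using xy golden_bounds by simp_all
  have "frac ((\<gamma> - 1) * y - x) = (\<gamma> - 1) * y - x + real (digit (x, y))"
  proof (cases "y < \<gamma> * x")
    case True
    then have "(\<gamma> - 1) * y < (\<gamma> - 1) * (\<gamma> * x)"
      using golden_bounds by simp
    then have "(\<gamma> - 1) * y < x" by (simp add: golden_simps)
    then have "\<lfloor>(\<gamma> - 1) * y - x\<rfloor> = - 1"
      using xy up by (simp add: floor_eq_iff)
    then show ?thesis using True by (simp add: frac_def digit_def)
  next
    case False
    then have "(\<gamma> - 1) * (\<gamma> * x) \<le> (\<gamma> - 1) * y"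
      using golden_bounds by simp
    then have "x \<le> (\<gamma> - 1) * y" by (simp add: golden_simps)
    then have "\<lfloor>(\<gamma> - 1) * y - x\<rfloor> = 0"
      using xy up golden_bounds unfolding floor_eq_iff by linarith
    then show ?thesis using False by (simp add: frac_def digit_def)
  qed
  then show ?thesis by (simp only: T_map_def eq case_prod_conv)
qed

lemma T_map_low:
  assumes "(x, y) \<in> unit_square" "\<gamma> * x \<le> y"
  shows "T_map (x, y) = (y, (\<gamma> - 1) * y - x)"
  using T_map_digit[OF assms(1)] assms(2) by (simp add: digit_def)

lemma T_map_high:
  assumes "(x, y) \<in> unit_square" "y < \<gamma> * x"
  shows "T_map (x, y) = (y, (\<gamma> - 1) * y - x + 1)"
  using T_map_digit[OF assms(1)] assms(2) by (simp add: digit_def)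

section \<open>Orbits in the unit square\<close>

lemma T_map_square: "z \<in> unit_square \<Longrightarrow> T_map z \<in> unit_square"
  by (auto simp: T_map_def unit_square_def frac_lt_1)

lemma funpow_square: "z \<in> unit_square \<Longrightarrow> (T_map ^^ n) z \<in> unit_square"
  by (induction n) (auto intro: T_map_square)

lemma funpow_split: "(T_map ^^ (i + j)) z = (T_map ^^ j) ((T_map ^^ i) z)"
  by (simp only: add.commute[of i j] funpow_add o_apply)

lemma T_map_inj: "inj_on T_map unit_square"
proof (rule inj_onI)
  fix z w assume zw: "z \<in> unit_square" "w \<in> unit_square" "T_map z = T_map w"
  obtain x y x' y' where z: "z = (x, y)" and w: "w = (x', y')" by fastforce
  \<comment> \<open>two preimages of a point differ by an integer in their first coordinate\<close>
  have "y = y'" and "x - x' = real (digit z) - real (digit w)"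
    using zw T_map_digit[of x y] T_map_digit[of x' y'] by (auto simp: z w)
  moreover have "\<bar>x - x'\<bar> < 1"
    using zw by (auto simp: z w unit_square_def)
  ultimately show "z = w"
    by (auto simp: z w digit_def split: if_splits)
qed

definition ones :: "nat \<Rightarrow> real \<times> real \<Rightarrow> nat" where
  "ones n z = (\<Sum>i<n. digit ((T_map ^^ i) z))"

lemma ones_simps [simp]: "ones 0 z = 0" "ones (Suc n) z = ones n z + digit ((T_map ^^ n) z)"
  by (simp_all add: ones_def)

lemma ones_add: "ones (m + n) z = ones m z + ones n ((T_map ^^ m) z)"
proof (induction n)
  case (Suc n)
  then show ?case by (simp add: funpow_add[symmetric] add.commute flip: comp_apply[of "T_map ^^ _" "T_map ^^ _"])
qed simp

lemma ones_Suc_shift: "ones (Suc n) z = digit z + ones n (T_map z)"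
  using ones_add[of 1 n z] by simp

lemma ones_multiple:
  assumes "\<And>z. z \<in> X \<Longrightarrow> (T_map ^^ r) z \<in> X" "\<And>z. z \<in> X \<Longrightarrow> ones r z = c" "z \<in> X"
  shows "ones (k * r) z = k * c"
proof -
  have "(T_map ^^ (k * r)) z \<in> X \<and> ones (k * r) z = k * c"
  proof (induction k)
    case (Suc k)
    have eq: "Suc k * r = k * r + r" by simp
    have "(T_map ^^ (k * r + r)) z = (T_map ^^ r) ((T_map ^^ (k * r)) z)"
      by (simp add: funpow_add add.commute)
    then show ?case
      using Suc assms unfolding eq ones_add by simp
  qed (use assms in simp)
  then show ?thesis ..
qed

section \<open>Minimal periods\<close>

text \<open>The minimal period is described by divisibility, which also covers every other period of the orbit
  and makes the transfer of minimal periods between orbits an equivalence of equations. The number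
  \<open>c\<close> of digits \<open>1\<close> is carried along because it determines the period of the shrunken orbit.\<close>

definition cycle_with :: "nat \<Rightarrow> nat \<Rightarrow> real \<times> real \<Rightarrow> bool" where
  "cycle_with p c z \<longleftrightarrow> p > 0 \<and> (\<forall>q. (T_map ^^ q) z = z \<longleftrightarrow> p dvd q) \<and> ones p z = c"

lemma T_period_cycle:
  assumes "cycle_with p c z"
  shows "T_period z = enat p"
proof -
  have "(INF p \<in> {p. p \<ge> 1 \<and> (T_map ^^ p) z = z}. enat p) = enat p"
    using assms by (intro antisym INF_lower INF_greatest) (auto simp: cycle_with_def dest: dvd_imp_le)
  then show ?thesis by (simp add: T_period_def)
qed

lemma funpow_mult_fixed:
  assumes "(T_map ^^ p) z = z" "p dvd q"
  shows "(T_map ^^ q) z = z"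
proof -
  obtain k where q: "q = p * k" using assms(2) by blast
  have "(T_map ^^ (p * k)) z = z"
    using assms(1) by (induction k) (simp_all add: funpow_add)
  then show ?thesis by (simp add: q)
qed

lemma cycle_exists:
  assumes "n > 0" "(T_map ^^ n) z = z"
  obtains p where "p dvd n" "cycle_with p (ones p z) z"
proof -
  define p where "p = (LEAST p. p > 0 \<and> (T_map ^^ p) z = z)"
  have p: "p > 0" "(T_map ^^ p) z = z"
    unfolding p_def using LeastI[of "\<lambda>p. p > 0 \<and> (T_map ^^ p) z = z" n] assms by auto
  have dvd: "p dvd q" if q: "(T_map ^^ q) z = z" for q
  proof -
    \<comment> \<open>cancelling multiples of \<open>p\<close> from the right leaves a period smaller than \<open>p\<close>, which must vanish\<close>
    have "(T_map ^^ (q mod p + p * (q div p))) z = z"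
      using q by simp
    then have "(T_map ^^ (q mod p)) z = z"
      unfolding funpow_add by (simp add: funpow_mult_fixed[OF p(2)])
    moreover have "q mod p < p" using p(1) by simp
    ultimately show ?thesis
      unfolding p_def using not_less_Least[of "q mod p" "\<lambda>p. p > 0 \<and> (T_map ^^ p) z = z"]
      by (metis (lifting) bot_nat_0.not_eq_extremum mod_eq_0_iff_dvd p_def)
  qed
  then have "cycle_with p (ones p z) z"
    using p by (auto simp: cycle_with_def intro: funpow_mult_fixed[OF p(2)])
  then show ?thesis
    using that dvd[OF assms(2)] by blast
qed

lemma prime_dvd_product_nat:
  assumes "prime (q::nat)" "q dvd a * b" "prime a" "prime b"
  shows "q = a \<or> q = b"
  using assms by (metis prime_dvd_mult_iff primes_dvd_imp_eq)

lemma small_primes: "prime (2::nat)" "prime (3::nat)" "prime (5::nat)"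
  by (simp_all add: prime_nat_iff' atLeastLessThan_nat_numeral upt_rec)

text \<open>A period that is not minimal is a proper multiple of the minimal one, so that dividing it by a
  suitable prime factor still gives a period.\<close>

lemma cycle_by_prime_divisors:
  assumes "n > 0" "(T_map ^^ n) z = z"
    and "\<And>q. prime q \<Longrightarrow> q dvd n \<Longrightarrow> (T_map ^^ (n div q)) z \<noteq> z"
  shows "cycle_with n (ones n z) z"
proof -
  obtain p where p: "p dvd n" "cycle_with p (ones p z) z"
    using cycle_exists assms by blast
  then obtain k where k: "n = p * k" by blast
  have "k = 1"
  proof (rule ccontr)
    assume "k \<noteq> 1"
    then obtain q where q: "prime q" "q dvd k"
      using prime_factor_nat by blast
    then have "p dvd n div q"
      by (simp add: k div_mult_swap[symmetric] flip: div_mult_swap)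
    moreover have "q dvd n" using q k by simp
    ultimately show False
      using assms(3)[OF q(1)] p(2) by (simp add: cycle_with_def)
  qed
  then show ?thesis using p k by simp
qed

text \<open>Injectivity of \<open>T\<close> makes \<open>z\<close> and \<open>T z\<close> have the same periods, and one period of \<open>T z\<close> shows the digits
  of one period of \<open>z\<close> in cyclic order.\<close>

lemma cycle_shift1:
  assumes "z \<in> unit_square"
  shows "cycle_with p c (T_map z) \<longleftrightarrow> cycle_with p c z"
proof -
  have fix_iff: "(T_map ^^ q) (T_map z) = T_map z \<longleftrightarrow> (T_map ^^ q) z = z" for q
    using assms T_map_inj funpow_square
    by (metis funpow_swap1 inj_on_eq_iff)
  have "ones p (T_map z) = ones p z" if "(T_map ^^ p) z = z"
    using ones_Suc_shift[of p z] that by simp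
  then show ?thesis
    unfolding cycle_with_def fix_iff by (metis dvd_refl)
qed

lemma cycle_shift:
  assumes "z \<in> unit_square"
  shows "cycle_with p c ((T_map ^^ m) z) \<longleftrightarrow> cycle_with p c z"
  using assms by (induction m) (simp_all add: cycle_shift1 funpow_square)

section \<open>The set \<open>\<D>\<close> and its copy \<open>\<D>/\<gamma>\<^sup>2\<close>\<close>

abbreviation shrink :: "real \<times> real \<Rightarrow> real \<times> real" where
  "shrink z \<equiv> z /\<^sub>R \<gamma>\<^sup>2"

lemma shrink_Pair: "shrink (x, y) = ((2 - \<gamma>) * x, (2 - \<gamma>) * y)"
  using golden_inverse(2) by (simp add: inverse_eq_divide)

lemma expand_shrink [simp]: "\<gamma>\<^sup>2 *\<^sub>R shrink z = z"
  using golden_bounds by simp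

lemma shrink_eq_iff [simp]: "shrink z = shrink w \<longleftrightarrow> z = w"
  using golden_bounds by simp

lemma D_set_iff:
  "(x, y) \<in> D_set \<longleftrightarrow> (x, y) \<in> unit_square \<and> (x, y) \<noteq> (0, 0)
     \<and> (\<gamma> * x \<le> y \<or> x + y \<le> 1 \<or> \<gamma> * y \<le> x)"
  by (auto simp: D_set_def R_set_def)

lemma D_set_square: "z \<in> D_set \<Longrightarrow> z \<in> unit_square"
  by (simp add: D_set_def)

lemma shrink_D_small: "w \<in> D_set \<Longrightarrow> shrink w \<in> D_small"
  unfolding D_small_def by (rule imageI)

lemma D_small_iff:
  "(x, y) \<in> D_small \<longleftrightarrow> 0 \<le> x \<and> 0 \<le> y \<and> x < 2 - \<gamma> \<and> y < 2 - \<gamma> \<and> (x, y) \<noteq> (0, 0)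
     \<and> (\<gamma> * x \<le> y \<or> x + y \<le> 2 - \<gamma> \<or> \<gamma> * y \<le> x)"
proof -
  define e where "e = \<gamma>\<^sup>2"
  have e: "e > 0" "e * (2 - \<gamma>) = 1"
    using golden_bounds golden_square by (auto simp: e_def power2_eq_square golden_simps)
  have "(x, y) \<in> D_small \<longleftrightarrow> (e * x, e * y) \<in> D_set"
  proof
    assume "(x, y) \<in> D_small"
    then obtain w where "w \<in> D_set" "(x, y) = shrink w" by (auto simp: D_small_def)
    then show "(e * x, e * y) \<in> D_set"
      using expand_shrink[of w] by (simp add: e_def flip: real_scaleR_def scaleR_Pair)
  next
    assume "(e * x, e * y) \<in> D_set"
    moreover have "(x, y) = shrink (e * x, e * y)" using e by (simp add: e_def)
    ultimately show "(x, y) \<in> D_small" unfolding D_small_def by blast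
  qed
  also have "\<dots> \<longleftrightarrow> 0 \<le> x \<and> 0 \<le> y \<and> x < 2 - \<gamma> \<and> y < 2 - \<gamma> \<and> (x, y) \<noteq> (0, 0)
     \<and> (\<gamma> * x \<le> y \<or> x + y \<le> 2 - \<gamma> \<or> \<gamma> * y \<le> x)"
  proof -
    have lt: "e * a < 1 \<longleftrightarrow> a < 2 - \<gamma>" and le: "e * a \<le> 1 \<longleftrightarrow> a \<le> 2 - \<gamma>" for a
      using e by (metis mult_less_cancel_left_pos, metis mult_le_cancel_left_pos)
    have cone: "\<gamma> * (e * a) \<le> e * b \<longleftrightarrow> \<gamma> * a \<le> b" for a b
      using e by (metis mult.left_commute mult_le_cancel_left_pos)
    show ?thesis
      unfolding D_set_iff unit_square_def cone
      using e le[of "x + y"] by (simp add: lt zero_le_mult_iff distrib_left) auto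
  qed
  finally show ?thesis .
qed

text \<open>Where the digit is \<open>1\<close>, the inequalities of \<open>\<R>\<close> for \<open>T z\<close> are \<open>1 < x + y\<close>, \<open>x < \<gamma>y\<close> and \<open>x < 1\<close>; where
  it is \<open>0\<close>, one of them says \<open>x < 0\<close>. So a point with image in \<open>\<R>\<close> lies in \<open>\<R>\<close> itself.\<close>

lemma T_map_D_set:
  assumes "z \<in> D_set"
  shows "T_map z \<in> D_set"
proof -
  obtain x y where z: "z = (x, y)" by fastforce
  have sq: "(x, y) \<in> unit_square" using assms by (simp add: D_set_def z)
  then have xy: "0 \<le> x" "x < 1" "0 \<le> y" "y < 1" by (auto simp: unit_square_def)
  show ?thesis
  proof (cases "y < \<gamma> * x")
    case True
    then show ?thesis
      using assms T_map_square[OF sq] xy golden_mult_strict_mono[of x 1]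
      by (auto simp: z D_set_iff T_map_high[OF sq True] golden_simps)
  next
    case False
    then have "\<gamma> * x \<le> y" by simp
    then show ?thesis
      using assms T_map_square[OF sq] xy golden_mult_mono[of 0 x]
      by (auto simp: z D_set_iff T_map_low[OF sq] golden_simps)
  qed
qed

lemma funpow_D_set: "z \<in> D_set \<Longrightarrow> (T_map ^^ n) z \<in> D_set"
  by (induction n) (auto intro: T_map_D_set)

section \<open>The first return to \<open>\<D>/\<gamma>\<^sup>2\<close>\<close>

text \<open>Where the digit is \<open>0\<close>, \<open>T\<close> is linear and the condition on the digit is homogeneous, so shrinking
  commutes with \<open>T\<close>.\<close>

lemma T_map_shrink_low:
  assumes "z \<in> unit_square" "digit z = 0"
  shows "T_map (shrink z) = shrink (T_map z)" "digit (shrink z) = 0"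
proof -
  obtain x y where z: "z = (x, y)" by fastforce
  have xy: "0 \<le> x" "x < 1" "0 \<le> y" "y < 1" "\<gamma> * x \<le> y"
    using assms by (auto simp: z unit_square_def digit_def split: if_splits)
  have "(2 - \<gamma>) * (\<gamma> * x) \<le> (2 - \<gamma>) * y"
    using xy golden_bounds by simp
  then have le: "\<gamma> * ((2 - \<gamma>) * x) \<le> (2 - \<gamma>) * y"
    by (simp add: mult.left_commute)
  have "(2 - \<gamma>) * a \<in> {0..<1}" if "0 \<le> a" "a < 1" for a
    using that golden_bounds mult_strict_mono'[of "2 - \<gamma>" 1 a 1] by simp
  then have sq: "((2 - \<gamma>) * x, (2 - \<gamma>) * y) \<in> unit_square"
    using xy by (simp add: unit_square_def)
  show "digit (shrink z) = 0"
    using le unfolding z shrink_Pair by (simp add: digit_def)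
  show "T_map (shrink z) = shrink (T_map z)"
    using T_map_low[OF sq le] T_map_low[of x y] assms(1) xy
    unfolding z shrink_Pair by (simp only: shrink_Pair) (simp add: algebra_simps)
qed

text \<open>The six iterates behind the block \<open>1,0,1,1,0,1\<close>. The formulas hold over \<open>\<D>/\<gamma>\<^sup>2\<close> and
  over \<open>\<R>/\<gamma>\<^sup>2\<close> alike, so they serve both for the return to \<open>\<D>/\<gamma>\<^sup>2\<close> and for the orbit of \<open>D\<^sub>\<beta>\<close>, and solving them for
  \<open>(x, y)\<close> describes the polygons that are passed on the way. The sixth iterate is \<open>T\<close> of the
  enlarged point, scaled down again: the linear part has order five, and the translations add up to
  \<open>(0, 1/\<gamma>\<^sup>2)\<close>.\<close>

lemma six_steps:
  assumes "0 \<le> x" "x < 2 - \<gamma>" "0 \<le> y" "y < 2 - \<gamma>" "y < \<gamma> * x"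
  defines "z \<equiv> (x, y)"
  shows "(T_map ^^ 1) z = (y, 1 - x + (\<gamma> - 1) * y)"
    and "(T_map ^^ 2) z = (1 - x + (\<gamma> - 1) * y, (\<gamma> - 1) * (1 - x - y))"
    and "(T_map ^^ 3) z = ((\<gamma> - 1) * (1 - x - y), 2 - \<gamma> + (\<gamma> - 1) * x - y)"
    and "(T_map ^^ 4) z = (2 - \<gamma> + (\<gamma> - 1) * x - y, \<gamma> - 1 + x)"
    and "(T_map ^^ 5) z = (\<gamma> - 1 + x, y)"
    and "(T_map ^^ 6) z = (y, 2 - \<gamma> - x + (\<gamma> - 1) * y)"
    and "digit ((T_map ^^ 0) z) = 1" "digit ((T_map ^^ 1) z) = 0" "digit ((T_map ^^ 2) z) = 1"
      "digit ((T_map ^^ 3) z) = 1" "digit ((T_map ^^ 4) z) = 0" "digit ((T_map ^^ 5) z) = 1"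
proof -
  note g = golden_bounds
  have ge: "0 \<le> \<gamma> * x" "0 \<le> \<gamma> * y" "\<gamma> * x < \<gamma> - 1" "\<gamma> * y < \<gamma> - 1"
    using assms(1-4) g golden_mult_strict_mono[of x "2 - \<gamma>"] golden_mult_strict_mono[of y "2 - \<gamma>"]
    by (simp_all add: golden_simps)
  have step: "(T_map ^^ m) z = (b, c)"
    if "(T_map ^^ n) z = (a, b)" "digit ((T_map ^^ n) z) = d" "m = Suc n"
      "c = (\<gamma> - 1) * b - a + real d" for m n a b c d
    using that funpow_square[of z n] T_map_digit[of a b] assms(1-4) g
    by (simp add: z_def unit_square_def)
  show 0: "digit ((T_map ^^ 0) z) = 1"
    using assms by (simp add: digit_def)
  show 1: "(T_map ^^ 1) z = (y, 1 - x + (\<gamma> - 1) * y)"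
    by (rule step[OF _ 0]) (simp_all add: z_def)
  show d1: "digit ((T_map ^^ 1) z) = 0"
    unfolding 1 by (simp add: digit_def golden_simps) (use assms(1-5) ge g in linarith)
  show 2: "(T_map ^^ 2) z = (1 - x + (\<gamma> - 1) * y, (\<gamma> - 1) * (1 - x - y))"
    by (rule step[OF 1 d1]) (simp_all add: golden_simps)
  show d2: "digit ((T_map ^^ 2) z) = 1"
    unfolding 2 by (simp add: digit_def golden_simps) (use assms(1-5) ge g in linarith)
  show 3: "(T_map ^^ 3) z = ((\<gamma> - 1) * (1 - x - y), 2 - \<gamma> + (\<gamma> - 1) * x - y)"
    by (rule step[OF 2 d2]) (simp_all add: golden_simps)
  show d3: "digit ((T_map ^^ 3) z) = 1"
    unfolding 3 by (simp add: digit_def golden_simps) (use assms(1-5) ge g in linarith)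
  show 4: "(T_map ^^ 4) z = (2 - \<gamma> + (\<gamma> - 1) * x - y, \<gamma> - 1 + x)"
    by (rule step[OF 3 d3]) (simp_all add: golden_simps)
  show d4: "digit ((T_map ^^ 4) z) = 0"
    unfolding 4 by (simp add: digit_def golden_simps) (use assms(1-5) ge g in linarith)
  show 5: "(T_map ^^ 5) z = (\<gamma> - 1 + x, y)"
    by (rule step[OF 4 d4]) (simp_all add: golden_simps)
  show d5: "digit ((T_map ^^ 5) z) = 1"
    unfolding 5 by (simp add: digit_def golden_simps) (use assms(1-5) ge g in linarith)
  show 6: "(T_map ^^ 6) z = (y, 2 - \<gamma> - x + (\<gamma> - 1) * y)"
    by (rule step[OF 5 d5]) (simp_all add: golden_simps)
qed

text \<open>For digit \<open>1\<close> each of the five intermediate points of \<open>six_steps\<close> has a coordinate of at least \<open>1/\<gamma>\<^sup>2\<close>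
  and is therefore outside \<open>\<D>/\<gamma>\<^sup>2\<close>. For the third of these points this is due
  to \<open>w \<in> \<D>\<close>: the two ways of avoiding \<open>\<R>\<close> make one or the other coordinate large.\<close>

lemma return_block:
  assumes "w \<in> D_set"
  shows "(T_map ^^ (1 + 5 * digit w)) (shrink w) = shrink (T_map w)"
    and "ones (1 + 5 * digit w) (shrink w) = 4 * digit w"
    and "0 < t \<Longrightarrow> t < 1 + 5 * digit w \<Longrightarrow> (T_map ^^ t) (shrink w) \<notin> D_small"
proof -
  obtain a b where w: "w = (a, b)" by fastforce
  define x y where "x = (2 - \<gamma>) * a" and "y = (2 - \<gamma>) * b"
  have s: "shrink w = (x, y)" by (simp only: w shrink_Pair x_def y_def)
  have sq: "w \<in> unit_square" using assms by (simp add: D_set_def)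
  have "(T_map ^^ (1 + 5 * digit w)) (shrink w) = shrink (T_map w)
    \<and> ones (1 + 5 * digit w) (shrink w) = 4 * digit w
    \<and> (0 < t \<longrightarrow> t < 1 + 5 * digit w \<longrightarrow> (T_map ^^ t) (shrink w) \<notin> D_small)"
  proof (cases "digit w = 0")
    case True
    then show ?thesis using T_map_shrink_low[OF sq] by simp
  next
    case False
    then have d: "digit w = 1" and ab: "b < \<gamma> * a"
      by (auto simp: digit_def w split: if_splits)
    have "(2 - \<gamma>) * b < (2 - \<gamma>) * (\<gamma> * a)"
      using ab golden_bounds by simp
    then have hi: "y < \<gamma> * x" by (simp add: x_def y_def mult.left_commute)
    have "(x, y) \<in> D_small"
      using assms s by (metis D_small_def imageI)
    then have xy: "0 \<le> x" "x < 2 - \<gamma>" "0 \<le> y" "y < 2 - \<gamma>"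
      and dis: "x + y \<le> 2 - \<gamma> \<or> \<gamma> * y \<le> x"
      using hi by (auto simp: D_small_iff)
    note six = six_steps[OF xy hi]
    have "T_map w = (b, (\<gamma> - 1) * b - a + 1)"
      using T_map_digit[of a b] sq d by (simp add: w)
    then have "shrink (T_map w) = (y, (2 - \<gamma>) * ((\<gamma> - 1) * b - a + 1))"
      by (simp only: shrink_Pair y_def)
    also have "\<dots> = (T_map ^^ 6) (shrink w)"
      unfolding s six(6) by (simp add: x_def y_def golden_simps)
    finally have 1: "(T_map ^^ 6) (shrink w) = shrink (T_map w)" ..
    have "{..<6} = {0, 1, 2, 3, 4, 5::nat}" by auto
    then have 2: "ones 6 (shrink w) = 4"
      unfolding ones_def s using six(7-12) by simp
    have 3: "(T_map ^^ t) (shrink w) \<notin> D_small" if t: "0 < t" "t < 6"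
    proof -
      have pos: "0 \<le> (\<gamma> - 1) * x" "0 \<le> (\<gamma> - 1) * y"
        using xy golden_bounds by simp_all
      have third: "2 - \<gamma> \<le> (\<gamma> - 1) * (1 - x - y) \<or> 2 - \<gamma> \<le> 2 - \<gamma> + (\<gamma> - 1) * x - y"
        using dis
      proof
        assume "x + y \<le> 2 - \<gamma>"
        then have "(\<gamma> - 1) * (\<gamma> - 1) \<le> (\<gamma> - 1) * (1 - x - y)"
          using golden_bounds by (intro mult_left_mono) auto
        then show ?thesis by (simp add: golden_simps)
      next
        assume "\<gamma> * y \<le> x"
        then have "(\<gamma> - 1) * (\<gamma> * y) \<le> (\<gamma> - 1) * x"
          using golden_bounds by (intro mult_left_mono) auto
        then show ?thesis by (simp add: golden_simps)
      qed
      have "t \<in> {1, 2, 3, 4, 5}" using t by auto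
      then show ?thesis
        using xy pos third golden_bounds
        by (elim insertE emptyE; simp only: s six D_small_iff) linarith+
    qed
    show ?thesis using 1 2 3 d by simp
  qed
  then show "(T_map ^^ (1 + 5 * digit w)) (shrink w) = shrink (T_map w)"
    "ones (1 + 5 * digit w) (shrink w) = 4 * digit w"
    "0 < t \<Longrightarrow> t < 1 + 5 * digit w \<Longrightarrow> (T_map ^^ t) (shrink w) \<notin> D_small"
    by blast+
qed

text \<open>Concatenating \<open>k\<close> return blocks: since a digit \<open>d\<close> contributes a block of length \<open>1 + 5d\<close> with \<open>4d\<close>
  digits \<open>1\<close>, the return times are \<open>k + 5 ones k w\<close>.\<close>

lemma return_orbit:
  assumes "w \<in> D_set"
  shows "(T_map ^^ (k + 5 * ones k w)) (shrink w) = shrink ((T_map ^^ k) w)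
    \<and> ones (k + 5 * ones k w) (shrink w) = 4 * ones k w"
proof (induction k)
  case (Suc k)
  let ?v = "(T_map ^^ k) w"
  define m n where "m = k + 5 * ones k w" and "n = 1 + 5 * digit ?v"
  have eq: "Suc k + 5 * ones (Suc k) w = m + n"
    by (simp add: m_def n_def)
  have "(T_map ^^ n) (shrink ?v) = shrink (T_map ?v)" "ones n (shrink ?v) = 4 * digit ?v"
    unfolding n_def by (rule return_block(1,2)[OF funpow_D_set[OF assms]])+
  moreover have "(T_map ^^ m) (shrink w) = shrink ?v" "ones m (shrink w) = 4 * ones k w"
    using Suc by (simp_all only: m_def)
  ultimately show ?case
    unfolding eq ones_add funpow_split by simp
qed simp

lemma return_times:
  assumes "w \<in> D_set" "(T_map ^^ t) (shrink w) \<in> D_small"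
  shows "\<exists>k. t = k + 5 * ones k w"
  using assms
proof (induction t arbitrary: w rule: less_induct)
  case (less t)
  show ?case
  proof (cases "t = 0")
    case True
    then have "t = 0 + 5 * ones 0 w" by simp
    then show ?thesis by blast
  next
    case False
    let ?b = "1 + 5 * digit w"
    have "\<not> t < ?b"
      using return_block(3)[OF less.prems(1)] less.prems(2) False by blast
    then have t: "t = ?b + (t - ?b)" by simp
    have "(T_map ^^ (t - ?b)) (shrink (T_map w)) = (T_map ^^ t) (shrink w)"
      using funpow_split[of ?b "t - ?b" "shrink w"]
      unfolding return_block(1)[OF less.prems(1)] t[symmetric] by (rule sym)
    then obtain k where "t - ?b = k + 5 * ones k (T_map w)"
      using less.IH[of "t - ?b" "T_map w"] less.prems T_map_D_set False by auto
    then have "t = Suc k + 5 * ones (Suc k) w"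
      using t by (simp add: ones_Suc_shift del: ones_simps)
    then show ?thesis by blast
  qed
qed

section \<open>Periods along the iterates of \<open>S\<close>\<close>

text \<open>A period of \<open>w/\<gamma>\<^sup>2\<close> is a return time to \<open>\<D>/\<gamma>\<^sup>2\<close>, hence of the form \<open>k + 5 ones k w\<close>, and it is a period
  exactly if \<open>k\<close> is one of \<open>w\<close>, that is if \<open>k = jp\<close>; then it equals \<open>j(p + 5c)\<close>.\<close>

lemma cycle_shrink:
  assumes w: "w \<in> D_set" and cyc: "cycle_with p c w"
  shows "cycle_with (p + 5 * c) (4 * c) (shrink w)"
proof -
  have p: "p > 0" "ones p w = c" and fix_iff: "(T_map ^^ q) w = w \<longleftrightarrow> p dvd q" for q
    using cyc by (auto simp: cycle_with_def)
  have mult: "ones (j * p) w = j * c" for j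
    by (rule ones_multiple[of "{w}"]) (use fix_iff p in auto)
  have "(T_map ^^ t) (shrink w) = shrink w \<longleftrightarrow> p + 5 * c dvd t" for t
  proof
    assume *: "(T_map ^^ t) (shrink w) = shrink w"
    then obtain k where k: "t = k + 5 * ones k w"
      using return_times[OF w, of t] shrink_D_small[OF w] by auto
    then have "(T_map ^^ k) w = w"
      using * return_orbit[OF w, of k] by simp
    then obtain j where "k = j * p" using fix_iff by (metis dvd_div_mult_self)
    then have "t = (p + 5 * c) * j" using k mult by (simp add: algebra_simps)
    then show "p + 5 * c dvd t" by simp
  next
    assume "p + 5 * c dvd t"
    then obtain j where "t = (p + 5 * c) * j" by blast
    then have "t = j * p + 5 * ones (j * p) w"
      by (simp add: mult algebra_simps)
    then show "(T_map ^^ t) (shrink w) = shrink w"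
      using return_orbit[OF w, of "j * p"] fix_iff[of "j * p"] by simp
  qed
  then show ?thesis
    using p return_orbit[OF w, of p] by (auto simp: cycle_with_def)
qed

lemma S_map_hits:
  assumes "z \<in> D_set - P_set"
  shows "S_map z \<in> D_set" "(T_map ^^ hit_time z) z = shrink (S_map z)"
proof -
  have "(T_map ^^ hit_time z) z \<in> D_small"
    unfolding hit_time_def using assms by (auto simp: P_set_def intro: LeastI)
  then obtain w where "w \<in> D_set" "(T_map ^^ hit_time z) z = shrink w"
    by (auto simp: D_small_def)
  then show "S_map z \<in> D_set" "(T_map ^^ hit_time z) z = shrink (S_map z)"
    using expand_shrink[of w] by (simp_all add: S_map_def)
qed

lemma cycle_S_map:
  assumes "z \<in> D_set - P_set" "cycle_with p c (S_map z)"
  shows "cycle_with (p + 5 * c) (4 * c) z"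
  using cycle_shrink[OF S_map_hits(1) assms(2)] assms(1) S_map_hits(2)[OF assms(1)]
    cycle_shift[of z _ _ "hit_time z"] by (metis Diff_iff D_set_square)

lemma S_iter_D_set: "S_iter n z = Some w \<Longrightarrow> w \<in> D_set"
  by (cases n) (auto split: if_splits option.splits intro: S_map_hits)

lemma S_iter_dichotomy:
  assumes "z \<in> D_set" "\<not> (\<forall>n. S_iter_in n z (D_set - P_set))"
  shows "\<exists>n. \<exists>w \<in> P_set. S_iter n z = Some w"
proof -
  define n where "n = (LEAST n. \<not> S_iter_in n z (D_set - P_set))"
  have not_n: "\<not> S_iter_in n z (D_set - P_set)"
    unfolding n_def using assms(2) by (metis (mono_tags, lifting) LeastI_ex)
  have before: "S_iter_in k z (D_set - P_set)" if "k < n" for k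
    using that not_less_Least unfolding n_def by blast
  obtain w where w: "S_iter n z = Some w"
  proof (cases n)
    case 0
    then show ?thesis using that assms(1) by simp
  next
    case (Suc k)
    then obtain v where "v \<in> D_set - P_set" "S_iter k z = Some v"
      using before[of k] by (auto simp: S_iter_in_def)
    then show ?thesis using that Suc by auto
  qed
  then show ?thesis
    using not_n S_iter_D_set[OF w] by (auto simp: S_iter_in_def)
qed

lemma power_four_decomposition:
  obtains l where "4 ^ n = 3 * l + (1::nat)"
proof -
  have "(4::nat) ^ n mod 3 = 1"
    by (induction n) (auto simp: mod_mult_right_eq[of 4, symmetric])
  then show ?thesis using that by (metis mult_div_mod_eq)
qed

text \<open>The number \<open>m = (4\<^sup>n - 1)/3 = 1 + 4 + \<dots> + 4\<^bsup>n-1\<^esup>\<close> sums the growth of the digit count under \<open>n\<close>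
  applications of \<open>cycle_S_map\<close>.\<close>

lemma cycle_S_iter:
  assumes "S_iter n z = Some w" "cycle_with p c w" "4 ^ n = 3 * m + (1::nat)"
  shows "cycle_with (p + 5 * c * m) (4 ^ n * c) z"
  using assms
proof (induction n arbitrary: w p c m)
  case 0
  then show ?case by (simp split: if_splits)
next
  case (Suc n)
  obtain v where v: "S_iter n z = Some v" "v \<in> D_set - P_set" "w = S_map v"
    using Suc.prems(1) by (auto split: option.splits if_splits)
  obtain l where l: "4 ^ n = 3 * l + (1::nat)"
    by (rule power_four_decomposition)
  then have "m = 4 * l + 1" using Suc.prems(3) by simp
  moreover have "cycle_with ((p + 5 * c) + 5 * (4 * c) * l) (4 ^ n * (4 * c)) z"
    using Suc.IH[OF v(1) _ l] cycle_S_map[OF v(2)] Suc.prems(2) v(3) by blast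
  ultimately show ?case by (simp add: algebra_simps)
qed

text \<open>Two digits \<open>0\<close> in a row give the second iterate the second coordinate \<open>-(x + y)/\<gamma>\<close>, which is
  non-negative only at the origin.\<close>

lemma no_two_zero_digits:
  assumes "w \<in> D_set" "digit w = 0" "digit (T_map w) = 0"
  shows False
proof -
  obtain x y where w: "w = (x, y)" by fastforce
  have D: "(x, y) \<in> D_set" using assms(1) by (simp add: w)
  then have sq: "(x, y) \<in> unit_square" by (rule D_set_square)
  have T: "T_map w = (y, (\<gamma> - 1) * y - x)"
    using T_map_digit[OF sq] assms(2) by (simp add: w)
  have "x + y \<le> 0"
    using assms(3) by (simp add: T digit_def golden_simps split: if_splits)
  then show False
    using D by (auto simp: D_set_iff unit_square_def)
qed

lemma cycle_ones_pos:
  assumes "w \<in> D_set" "cycle_with p c w"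
  shows "c > 0"
proof (rule ccontr)
  assume "\<not> c > 0"
  then have zero: "digit ((T_map ^^ i) w) = 0" if "i < p" for i
    using that assms(2) by (auto simp: cycle_with_def ones_def)
  have "p > 0" "(T_map ^^ p) w = w" using assms(2) by (auto simp: cycle_with_def)
  then have "digit w = 0" "digit (T_map w) = 0"
    using zero[of 0] zero[of 1] by (cases "p = 1"; simp)+
  then show False using no_two_zero_digits assms(1) by blast
qed

text \<open>The converse direction to \<open>cycle_S_map\<close>: periodicity passes from \<open>z\<close> to \<open>S z\<close>, with a smaller period
  because the digit count is positive.\<close>

lemma cycle_descends:
  assumes "z \<in> D_set - P_set" "cycle_with p c z"
  obtains p' c' where "cycle_with p' c' (S_map z)" "p' < p"
proof -
  let ?w = "S_map z"
  note w = S_map_hits[OF assms(1)]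
  have cyc: "cycle_with p c (shrink ?w)"
    unfolding w(2)[symmetric] using cycle_shift assms D_set_square by blast
  then have p: "p > 0" "(T_map ^^ p) (shrink ?w) = shrink ?w"
    by (auto simp: cycle_with_def)
  then obtain k where k: "p = k + 5 * ones k ?w"
    using return_times[OF w(1), of p] shrink_D_small[OF w(1)] by auto
  then have "k > 0" "(T_map ^^ k) ?w = ?w"
    using p return_orbit[OF w(1), of k] by (auto intro: gr0I)
  then obtain p' where p': "cycle_with p' (ones p' ?w) ?w"
    using cycle_exists by blast
  let ?c = "ones p' ?w"
  have "cycle_with (p' + 5 * ?c) (4 * ?c) (shrink ?w)"
    by (rule cycle_shrink[OF w(1) p'])
  then have "p = p' + 5 * ?c"
    using cyc unfolding cycle_with_def by (metis dvd_antisym dvd_refl)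
  then show ?thesis
    using that p' cycle_ones_pos[OF w(1) p'] by simp
qed

lemma not_periodic:
  assumes "\<And>n. S_iter_in n z (D_set - P_set)"
  shows "T_period z = \<infinity>"
proof -
  have False if q: "q \<ge> 1" "(T_map ^^ q) z = z" for q
  proof -
    obtain p where p: "cycle_with p (ones p z) z"
      using cycle_exists[of q z] q by auto
    \<comment> \<open>each application of \<open>S\<close> lowers the period by at least one\<close>
    have "\<exists>w p' c'. S_iter n z = Some w \<and> cycle_with p' c' w \<and> p' + n \<le> p" for n
    proof (induction n)
      case 0
      have "z \<in> D_set" using assms[of 0] by (auto simp: S_iter_in_def split: if_splits)
      then show ?case using p by auto
    next
      case (Suc n)
      then obtain w p' c' where w: "S_iter n z = Some w" "cycle_with p' c' w" "p' + n \<le> p"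
        by blast
      then have "w \<in> D_set - P_set" using assms[of n] by (auto simp: S_iter_in_def)
      moreover from this obtain p'' c'' where "cycle_with p'' c'' (S_map w)" "p'' < p'"
        using cycle_descends w(2) by blast
      ultimately have "S_iter (Suc n) z = Some (S_map w) \<and> cycle_with p'' c'' (S_map w)
          \<and> p'' + Suc n \<le> p"
        using w by simp
      then show ?case by blast
    qed
    from this[of p] show False by (auto simp: cycle_with_def)
  qed
  then have "{p. p \<ge> 1 \<and> (T_map ^^ p) z = z} = {}" by auto
  then show ?thesis
    unfolding T_period_def by (simp only: image_empty Inf_empty top_enat_def)
qed

section \<open>Periods in \<open>\<R>\<close>\<close>

lemma R_set_nonzero_iff:
  "(x, y) \<in> R_set - {(0, 0)} \<longleftrightarrow> (x, y) \<in> unit_square \<and> y < \<gamma> * x \<and> 1 < x + y \<and> x < \<gamma> * y"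
  by (auto simp: R_set_def)

lemma R_set_digit: "z \<in> R_set - {(0, 0)} \<Longrightarrow> digit z = 1"
  by (cases z) (simp only: R_set_nonzero_iff, simp add: digit_def)

lemma T_map_R_set:
  assumes "z \<in> R_set - {(0, 0)}"
  shows "T_map z \<in> R_set - {(0, 0)}"
proof -
  obtain x y where z: "z = (x, y)" by fastforce
  have sq: "(x, y) \<in> unit_square" and xy: "y < \<gamma> * x" "1 < x + y" "x < \<gamma> * y"
    using assms unfolding z R_set_nonzero_iff by auto
  have "x < 1" using sq by (simp add: unit_square_def)
  then show ?thesis
    using T_map_square[OF sq] xy golden_mult_strict_mono[of x 1]
    unfolding z T_map_high[OF sq xy(1)] R_set_nonzero_iff by (simp add: golden_simps)
qed

lemma funpow_R_set: "w \<in> R_set - {(0, 0)} \<Longrightarrow> (T_map ^^ n) w \<in> R_set - {(0, 0)}"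
  by (induction n) (use T_map_R_set in auto)

text \<open>Since the digit stays \<open>1\<close>, the iterates are those of an affine map of order five.\<close>

lemma R_set_rotation:
  assumes "(x, y) \<in> R_set - {(0, 0)}"
  shows "(T_map ^^ 1) (x, y) = (y, 1 - x + (\<gamma> - 1) * y)"
    and "(T_map ^^ 3) (x, y) = (\<gamma> - (\<gamma> - 1) * (x + y), 1 + (\<gamma> - 1) * x - y)"
    and "(T_map ^^ 5) (x, y) = (x, y)"
proof -
  note inR = funpow_R_set[OF assms]
  have step: "(T_map ^^ m) (x, y) = (b, c)"
    if "(T_map ^^ n) (x, y) = (a, b)" "m = Suc n" "c = 1 - a + (\<gamma> - 1) * b" for m n a b c
    using inR[of n] that R_set_digit[of "(a, b)"] T_map_digit[of a b]
    by (auto simp: R_set_def)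
  show 1: "(T_map ^^ 1) (x, y) = (y, 1 - x + (\<gamma> - 1) * y)"
    by (rule step[of 0]) simp_all
  have 2: "(T_map ^^ 2) (x, y) = (1 - x + (\<gamma> - 1) * y, \<gamma> - (\<gamma> - 1) * (x + y))"
    by (rule step[OF 1]) (simp_all add: golden_simps)
  show 3: "(T_map ^^ 3) (x, y) = (\<gamma> - (\<gamma> - 1) * (x + y), 1 + (\<gamma> - 1) * x - y)"
    by (rule step[OF 2]) (simp_all add: golden_simps)
  have 4: "(T_map ^^ 4) (x, y) = (1 + (\<gamma> - 1) * x - y, x)"
    by (rule step[OF 3]) (simp_all add: golden_simps)
  show "(T_map ^^ 5) (x, y) = (x, y)"
    by (rule step[OF 4]) (simp_all add: golden_simps)
qed

lemma z_R_coordinates: "z_R = ((\<gamma> + 1) / (\<gamma> + 2), (\<gamma> + 1) / (\<gamma> + 2))"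
  by (simp add: z_R_def power2_eq_square golden_square add.commute)

lemma R_set_fixed_iff:
  assumes "z \<in> R_set - {(0, 0)}"
  shows "T_map z = z \<longleftrightarrow> z = z_R"
proof -
  obtain x y where z: "z = (x, y)" by fastforce
  have eq: "(3 - \<gamma>) * a = 1 \<longleftrightarrow> a = (\<gamma> + 1) / (\<gamma> + 2)" for a
  proof -
    \<comment> \<open>\<open>(\<gamma> + 1)(3 - \<gamma>) = \<gamma> + 2\<close>\<close>
    have "(3 - \<gamma>) * a = 1 \<longleftrightarrow> (\<gamma> + 1) * ((3 - \<gamma>) * a) = (\<gamma> + 1) * 1"
      using golden_bounds by (subst mult_cancel_left) simp
    also have "(\<gamma> + 1) * ((3 - \<gamma>) * a) = a * (\<gamma> + 2)"
      by (simp add: golden_simps)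
    finally show ?thesis
      using golden_bounds by (simp add: eq_divide_eq)
  qed
  have "T_map z = z \<longleftrightarrow> x = y \<and> (3 - \<gamma>) * x = 1"
    using R_set_rotation(1)[of x y] assms by (auto simp: z golden_simps)
  then show ?thesis
    unfolding z z_R_coordinates eq by auto
qed

lemma z_R_in_R_set: "z_R \<in> R_set - {(0, 0)}"
proof -
  define c where "c = (\<gamma> + 1) / (\<gamma> + 2)"
  have "0 < c" "c < 1" "1 < 2 * c"
    using golden_bounds by (simp_all add: c_def field_simps)
  moreover from this have "1 * c < \<gamma> * c"
    using golden_bounds by (intro mult_strict_right_mono) linarith+
  ultimately show ?thesis
    unfolding z_R_coordinates R_set_nonzero_iff c_def[symmetric] by (simp add: unit_square_def)
qed

lemma cycle_R_set:
  assumes "z \<in> R_set - {(0, 0), z_R}"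
  shows "\<exists>c. cycle_with 5 c z"
proof -
  have z: "z \<in> R_set - {(0, 0)}" "T_map z \<noteq> z"
    using assms R_set_fixed_iff by blast+
  have "(T_map ^^ 5) z = z"
    using R_set_rotation(3)[of "fst z" "snd z"] z by simp
  then have "cycle_with 5 (ones 5 z) z"
  proof (rule cycle_by_prime_divisors[rotated])
    fix q :: nat assume "prime q" "q dvd 5"
    then have "q = 5" using small_primes primes_dvd_imp_eq by blast
    then show "(T_map ^^ (5 div q)) z \<noteq> z" using z(2) by simp
  qed simp
  then show ?thesis ..
qed

section \<open>Periods in \<open>D\<^sub>\<beta>\<close> and \<open>D\<^sub>\<alpha>\<close>\<close>

lemma D_beta_eq: "D_beta = shrink ` (R_set - {(0, 0)})"
  by (simp add: D_beta_def)

lemma z_beta_eq: "z_beta = shrink z_R"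
  using golden_bounds by (simp add: z_beta_def z_R_def)

text \<open>On \<open>\<R>\<close> and on its shrunken copy \<open>D\<^sub>\<beta>\<close>, the map \<open>T\<^sup>3\<close> is affine with the same linear part, and it fixes
  \<open>z_R\<close> and \<open>z_R/\<gamma>\<^sup>2\<close>, respectively; so shrinking commutes with \<open>T\<^sup>3\<close>. This carries the rotation of \<open>\<R>\<close>
  over to \<open>D\<^sub>\<beta>\<close>.\<close>

lemma D_beta_third_iterate:
  assumes "w \<in> R_set - {(0, 0)}"
  shows "(T_map ^^ 3) (shrink w) = shrink ((T_map ^^ 3) w)"
    and "digit (shrink w) = 1" "digit (T_map (shrink w)) = 0"
    and "ones 3 (shrink w) = 2" "shrink w \<in> unit_square"
proof -
  obtain a b where w: "w = (a, b)" by fastforce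
  define x y where "x = (2 - \<gamma>) * a" and "y = (2 - \<gamma>) * b"
  have s: "shrink w = (x, y)" by (simp only: w shrink_Pair x_def y_def)
  have *: "0 \<le> a" "a < 1" "0 \<le> b" "b < 1" "b < \<gamma> * a"
    using assms unfolding w R_set_nonzero_iff by (auto simp: unit_square_def)
  then have "(2 - \<gamma>) * b < (2 - \<gamma>) * (\<gamma> * a)" "(2 - \<gamma>) * a < (2 - \<gamma>) * 1" "(2 - \<gamma>) * b < (2 - \<gamma>) * 1"
    using golden_bounds by simp_all
  then have xy: "0 \<le> x" "x < 2 - \<gamma>" "0 \<le> y" "y < 2 - \<gamma>" "y < \<gamma> * x"
    using * golden_bounds by (simp_all add: x_def y_def mult.left_commute)
  note six = six_steps[OF xy]
  show "(T_map ^^ 3) (shrink w) = shrink ((T_map ^^ 3) w)"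
    unfolding s six(3) using assms unfolding w
    by (simp only: R_set_rotation(2) shrink_Pair) (simp add: x_def y_def golden_simps)
  show "digit (shrink w) = 1" "digit (T_map (shrink w)) = 0"
    unfolding s using six(7,8) by simp_all
  have "{..<3} = {0, 1, 2::nat}" by auto
  then show "ones 3 (shrink w) = 2"
    unfolding ones_def s using six(7-9) by simp
  show "shrink w \<in> unit_square"
    unfolding s using xy golden_bounds by (simp add: unit_square_def)
qed

lemma D_beta_iterates:
  assumes "w \<in> R_set - {(0, 0)}"
  shows "(T_map ^^ (3 * k)) (shrink w) = shrink ((T_map ^^ (3 * k)) w)"
proof (induction k)
  case (Suc k)
  have "3 * Suc k = 3 * k + 3" by simp
  then show ?case
    using Suc D_beta_third_iterate(1)[OF funpow_R_set[OF assms, of "3 * k"]]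
    by (simp only: funpow_split)
qed simp

text \<open>Fifteen is a period by the rotation of \<open>\<R>\<close>. It remains to exclude the proper divisors: \<open>3\<close> is a period
  only at the centre, and \<open>5\<close> is excluded by digits, because the digit of \<open>z\<close> is \<open>1\<close> and that of
  \<open>T\<^bsup>10\<^esup> z\<close>, a point of \<open>T(D\<^sub>\<beta>)\<close>, is \<open>0\<close>.\<close>

lemma cycle_D_beta:
  assumes "z \<in> D_beta"
  shows "cycle_with (if z = z_beta then 3 else 15) (if z = z_beta then 2 else 10) z"
proof -
  obtain w where w: "w \<in> R_set - {(0, 0)}" and z: "z = shrink w"
    using assms unfolding D_beta_eq by blast
  have w5: "(T_map ^^ 5) w = w"
    using R_set_rotation(3)[of "fst w" "snd w"] w by simp
  have iter: "(T_map ^^ (3 * k)) z = z \<longleftrightarrow> (T_map ^^ (3 * k)) w = w" for k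
    unfolding z D_beta_iterates[OF w] by (rule shrink_eq_iff)
  have 3: "(T_map ^^ 3) z = z \<longleftrightarrow> z = z_beta"
  proof -
    have "(T_map ^^ 3) w = w \<longleftrightarrow> T_map w = w"
    proof
      assume *: "(T_map ^^ 3) w = w"
      have "(T_map ^^ 6) w = w" by (rule funpow_mult_fixed[OF *]) simp
      moreover have "(T_map ^^ 6) w = T_map ((T_map ^^ 5) w)" by (simp add: eval_nat_numeral)
      ultimately show "T_map w = w" using w5 by simp
    next
      assume "T_map w = w"
      then show "(T_map ^^ 3) w = w" by (simp add: eval_nat_numeral)
    qed
    then show ?thesis
      using iter[of 1] R_set_fixed_iff[OF w] unfolding z z_beta_eq shrink_eq_iff mult_1_right by blast
  qed
  have "(T_map ^^ 15) w = w" by (rule funpow_mult_fixed[OF w5]) simp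
  then have 15: "(T_map ^^ 15) z = z"
    using iter[of 5] by simp
  have 5: "(T_map ^^ 5) z \<noteq> z"
  proof
    assume *: "(T_map ^^ 5) z = z"
    let ?v = "(T_map ^^ 9) w"
    have "(T_map ^^ 10) z = z" by (rule funpow_mult_fixed[OF *]) simp
    then have "z = (T_map ^^ (9 + 1)) z" by simp
    also have "\<dots> = T_map ((T_map ^^ 9) z)" using funpow_split[of 9 1 z] by simp
    also have "(T_map ^^ 9) z = shrink ?v"
      using D_beta_iterates[OF w, of 3] by (simp add: z)
    finally show False
      using D_beta_third_iterate(2)[OF w] D_beta_third_iterate(3)[OF funpow_R_set[OF w, of 9]]
      by (simp add: z)
  qed
  have ones: "ones (k * 3) z = k * 2" for k
  proof (rule ones_multiple[of D_beta])
    fix v assume "v \<in> D_beta"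
    then obtain u where u: "u \<in> R_set - {(0, 0)}" "v = shrink u"
      unfolding D_beta_eq by blast
    show "(T_map ^^ 3) v \<in> D_beta" "ones 3 v = 2"
      unfolding u(2) D_beta_third_iterate(1,4)[OF u(1)] D_beta_eq
      using funpow_R_set[OF u(1), of 3] by blast+
  qed (rule assms)
  show ?thesis
  proof (cases "z = z_beta")
    case True
    have "cycle_with 3 (ones 3 z) z"
    proof (rule cycle_by_prime_divisors)
      fix q :: nat assume "prime q" "q dvd 3"
      then have "q = 3" using small_primes primes_dvd_imp_eq by blast
      moreover have "(T_map ^^ 1) z \<noteq> z"
        by (rule notI, drule funpow_mult_fixed[of 1 z 5]) (use 5 in auto)
      ultimately show "(T_map ^^ (3 div q)) z \<noteq> z" by simp
    qed (use True 3 in auto)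
    then show ?thesis using True ones[of 1] by simp
  next
    case False
    have "cycle_with 15 (ones 15 z) z"
    proof (rule cycle_by_prime_divisors)
      fix q :: nat assume "prime q" "q dvd 15"
      then have "q = 3 \<or> q = 5" using small_primes prime_dvd_product_nat[of q 3 5] by simp
      then show "(T_map ^^ (15 div q)) z \<noteq> z" using 5 3 False by auto
    qed (use 15 in auto)
    then show ?thesis using False ones[of 5] by simp
  qed
qed

lemma D_alpha_iff:
  "(x, y) \<in> D_alpha \<longleftrightarrow> (x, y) \<in> unit_square \<and> \<gamma> * x \<le> y \<and> 2 - \<gamma> \<le> y \<and> x + y \<le> 1
     \<and> \<gamma> * y \<le> 1 + x"
proof -
  have "y \<le> (1 + x) / \<gamma> \<longleftrightarrow> \<gamma> * y \<le> 1 + x"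
    using golden_bounds by (simp add: field_simps)
  moreover have "2 - \<gamma> \<le> y \<Longrightarrow> y \<noteq> 0" using golden_bounds by auto
  ultimately show ?thesis
    unfolding D_alpha_def golden_inverse(2) by auto
qed

text \<open>The digits alternate between \<open>0\<close> on \<open>D\<^sub>\<alpha>\<close> and \<open>1\<close> on \<open>T(D\<^sub>\<alpha>)\<close>. The second iterate permutes the sides
  of the pentagon \<open>D\<^sub>\<alpha>\<close>, the side \<open>x = 0\<close> included.\<close>

lemma D_alpha_second_iterate:
  assumes "(x, y) \<in> D_alpha"
  shows "T_map (x, y) = (y, (\<gamma> - 1) * y - x)"
    and "(T_map ^^ 2) (x, y) = ((\<gamma> - 1) * y - x, 1 - (\<gamma> - 1) * (x + y))"
    and "(T_map ^^ 2) (x, y) \<in> D_alpha"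
    and "digit (x, y) = 0" "digit (T_map (x, y)) = 1"
proof -
  have sq: "(x, y) \<in> unit_square" and *: "\<gamma> * x \<le> y" "2 - \<gamma> \<le> y" "x + y \<le> 1" "\<gamma> * y \<le> 1 + x"
    using assms by (auto simp: D_alpha_iff)
  have xy: "0 \<le> x" "x < 1" "0 \<le> y" "y < 1" using sq by (auto simp: unit_square_def)
  show 1: "T_map (x, y) = (y, (\<gamma> - 1) * y - x)"
    by (rule T_map_low[OF sq *(1)])
  show "digit (x, y) = 0" using * by (simp add: digit_def)
  have hi: "(\<gamma> - 1) * y - x < \<gamma> * y"
    using * xy golden_bounds by (simp add: golden_simps)
  show "digit (T_map (x, y)) = 1" using hi by (simp add: 1 digit_def)
  show 2: "(T_map ^^ 2) (x, y) = ((\<gamma> - 1) * y - x, 1 - (\<gamma> - 1) * (x + y))"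
    using T_map_high[OF _ hi] T_map_square[OF sq] 1
    by (simp add: numeral_2_eq_2 golden_simps)
  have "(\<gamma> - 1) * (x + y) \<le> (\<gamma> - 1) * 1" "\<gamma> * (2 - \<gamma>) \<le> \<gamma> * y" "0 \<le> \<gamma> * x"
    using * xy golden_bounds by simp_all
  then have gs: "(\<gamma> - 1) * (x + y) \<le> \<gamma> - 1" "\<gamma> - 1 \<le> \<gamma> * y" "0 \<le> \<gamma> * x"
    by (simp_all add: golden_simps)
  show "(T_map ^^ 2) (x, y) \<in> D_alpha"
    using funpow_square[OF sq, of 2] gs * xy unfolding 2 D_alpha_iff
    by (simp only:) (simp add: golden_simps)
qed

lemma z_alpha_coordinates: "z_alpha = ((\<gamma> - 1) / (\<gamma> + 2), 2 / (\<gamma> + 2))"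
proof -
  have "\<gamma>\<^sup>2 + 1 = \<gamma> + 2" by (simp add: power2_eq_square golden_square)
  then show ?thesis by (simp only: z_alpha_def golden_inverse)
qed

text \<open>The equations for a fixed point of \<open>T\<^sup>2\<close> amount to the coordinates of \<open>z_alpha\<close> with the denominator
  \<open>\<gamma> + 2\<close> cleared.\<close>

lemma D_alpha_fixed_iff:
  assumes "z \<in> D_alpha"
  shows "(T_map ^^ 2) z = z \<longleftrightarrow> z = z_alpha"
proof -
  obtain x y where z: "z = (x, y)" by fastforce
  have pos: "\<gamma> + 2 > 0" using golden_bounds by simp
  have "(T_map ^^ 2) z = z \<longleftrightarrow> x * (\<gamma> + 2) = \<gamma> - 1 \<and> y * (\<gamma> + 2) = 2"
  proof
    assume "(T_map ^^ 2) z = z"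
    then have *: "(\<gamma> - 1) * y = 2 * x" "1 - (\<gamma> - 1) * (x + y) = y"
      using D_alpha_second_iterate(2) assms by (auto simp: z)
    then have "\<gamma> * ((\<gamma> - 1) * y) = \<gamma> * (2 * x)" "\<gamma> * (1 - (\<gamma> - 1) * (x + y)) = \<gamma> * y"
      "\<gamma> * (\<gamma> * (1 - (\<gamma> - 1) * (x + y))) = \<gamma> * (\<gamma> * y)" by simp_all
    with * show "x * (\<gamma> + 2) = \<gamma> - 1 \<and> y * (\<gamma> + 2) = 2"
      by (simp add: golden_simps)
  next
    assume *: "x * (\<gamma> + 2) = \<gamma> - 1 \<and> y * (\<gamma> + 2) = 2"
    then have "((\<gamma> - 1) * y) * (\<gamma> + 2) = (2 * x) * (\<gamma> + 2)"
      by (simp add: mult.assoc)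
    then have 1: "(\<gamma> - 1) * y = 2 * x" using pos by simp
    moreover have "\<gamma> * ((\<gamma> - 1) * y) = \<gamma> * (2 * x)" "\<gamma> * (x * (\<gamma> + 2)) = \<gamma> * (\<gamma> - 1)"
      using 1 * by simp_all
    ultimately show "(T_map ^^ 2) z = z"
      using * D_alpha_second_iterate(2) assms by (simp add: z golden_simps)
  qed
  then show ?thesis
    using pos by (auto simp: z z_alpha_coordinates field_simps)
qed

text \<open>As \<open>T\<^sup>2\<close> is a rotation of order five, \<open>10\<close> is a period. Odd periods are impossible because the digit
  alternates, and \<open>2\<close> is a period only at the centre.\<close>

lemma cycle_D_alpha:
  assumes "z \<in> D_alpha"
  shows "cycle_with (if z = z_alpha then 2 else 10) (if z = z_alpha then 1 else 5) z"
proof -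
  have closed: "(T_map ^^ (2 * k)) v \<in> D_alpha" if "v \<in> D_alpha" for k v
  proof (induction k)
    case (Suc k)
    have "2 * Suc k = 2 * k + 2" by simp
    then show ?case
      using D_alpha_second_iterate(3)[of "fst ((T_map ^^ (2 * k)) v)" "snd ((T_map ^^ (2 * k)) v)"] Suc
      by (simp only: funpow_split) simp
  qed (use that in simp)
  have digits: "digit v = 0" "digit (T_map v) = 1" if "v \<in> D_alpha" for v
    using that D_alpha_second_iterate(4,5)[of "fst v" "snd v"] by simp_all
  have odd: "(T_map ^^ Suc (2 * k)) z \<noteq> z" for k
    using digits(1)[OF assms] digits(2)[OF closed[OF assms, of k]] by auto
  have 10: "(T_map ^^ 10) z = z"
  proof -
    obtain x y where z: "z = (x, y)" by fastforce
    have step: "(T_map ^^ m) z = (c, d)"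
      if "(T_map ^^ (2 * k)) z = (a, b)" "m = 2 * Suc k" "c = (\<gamma> - 1) * b - a" "d = 1 - (\<gamma> - 1) * (a + b)"
      for k m a b c d
    proof -
      have "m = 2 * k + 2" using that by simp
      then show ?thesis
        using that D_alpha_second_iterate(2)[of a b] closed[OF assms, of k]
        by (simp only: funpow_split)
    qed
    \<comment> \<open>five applications of the rotation\<close>
    have 2: "(T_map ^^ (2 * 1)) z = ((\<gamma> - 1) * y - x, 1 - (\<gamma> - 1) * (x + y))"
      by (rule step[of 0 x y]) (simp_all add: z)
    have 4: "(T_map ^^ (2 * 2)) z = (\<gamma> - 1 + (\<gamma> - 1) * x - y, 2 - \<gamma> + x)"
      by (rule step[OF 2]) (simp_all add: golden_simps)
    have 6: "(T_map ^^ (2 * 3)) z = (\<gamma> - 2 + y, 2 - \<gamma> - x + (\<gamma> - 1) * y)"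
      by (rule step[OF 4]) (simp_all add: golden_simps)
    have 8: "(T_map ^^ (2 * 4)) z = ((\<gamma> - 1) * (1 - x - y), 1 - y + (\<gamma> - 1) * x)"
      by (rule step[OF 6]) (simp_all add: golden_simps)
    have "(T_map ^^ 10) z = (x, y)"
      by (rule step[OF 8]) (simp_all add: golden_simps)
    then show ?thesis by (simp add: z)
  qed
  have ones: "ones (k * 2) z = k * 1" for k
    by (rule ones_multiple[OF _ _ assms])
      (use closed[of _ 1] digits in \<open>auto simp: numeral_2_eq_2\<close>)
  show ?thesis
  proof (cases "z = z_alpha")
    case True
    have "cycle_with 2 (ones 2 z) z"
    proof (rule cycle_by_prime_divisors)
      fix q :: nat assume "prime q" "q dvd 2"
      then have "q = 2" using small_primes primes_dvd_imp_eq by blast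
      then show "(T_map ^^ (2 div q)) z \<noteq> z" using odd[of 0] by simp
    qed (use True D_alpha_fixed_iff[OF assms] in auto)
    then show ?thesis using True ones[of 1] by simp
  next
    case False
    have "cycle_with 10 (ones 10 z) z"
    proof (rule cycle_by_prime_divisors)
      fix q :: nat assume "prime q" "q dvd 10"
      then have "q = 2 \<or> q = 5" using small_primes prime_dvd_product_nat[of q 2 5] by simp
      then show "(T_map ^^ (10 div q)) z \<noteq> z"
        using odd[of 2] False D_alpha_fixed_iff[OF assms] by (auto simp del: funpow.simps)
    qed (use 10 in auto)
    then show ?thesis using False ones[of 5] by simp
  qed
qed

section \<open>Points that never reach \<open>\<D>/\<gamma>\<^sup>2\<close>\<close>

text \<open>The common conclusion of all cases of the decomposition of \<open>\<D>\<close> into polygons.\<close>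

definition covered :: "real \<times> real \<Rightarrow> bool" where
  "covered z \<longleftrightarrow> (\<exists>m. (T_map ^^ m) z \<in> D_small)
     \<or> (\<exists>m \<in> {0, 1}. \<exists>w \<in> D_alpha. z = (T_map ^^ m) w)
     \<or> (\<exists>m \<in> {0, 1, 2}. \<exists>w \<in> D_beta. z = (T_map ^^ m) w)"

lemma coveredI: "(T_map ^^ m) z \<in> D_small \<Longrightarrow> covered z"
  unfolding covered_def by blast

text \<open>A point that \<open>six_steps\<close> reaches from \<open>(x, y)\<close> after \<open>i\<close> steps is either on its way back to \<open>\<D>/\<gamma>\<^sup>2\<close>, if
  \<open>(x, y)\<close> is a point of \<open>\<D>/\<gamma>\<^sup>2\<close>, or on the orbit of \<open>D\<^sub>\<beta>\<close>, if \<open>(x, y)\<close> is in \<open>\<R>/\<gamma>\<^sup>2\<close>. For \<open>i \<le> 2\<close>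
  the polygon of such points is thus covered as a whole; for larger \<open>i\<close> the part over \<open>\<R>/\<gamma>\<^sup>2\<close> falls
  back onto \<open>D\<^sub>\<beta>\<close> or its images.\<close>

lemma tower_covered:
  assumes xy: "0 \<le> x" "x < 2 - \<gamma>" "0 \<le> y" "y < 2 - \<gamma>" "y < \<gamma> * x"
    and z: "z = (T_map ^^ i) (x, y)"
    and "i \<le> 2 \<or> i \<le> 6 \<and> (x + y \<le> 2 - \<gamma> \<or> \<gamma> * y \<le> x)"
  shows "covered z"
proof (cases "x + y \<le> 2 - \<gamma> \<or> \<gamma> * y \<le> x")
  case True
  have "x \<noteq> 0" using xy by auto
  then have "(x, y) \<in> D_small" using xy True by (simp add: D_small_iff)
  then obtain w where w: "w \<in> D_set" "(x, y) = shrink w" by (auto simp: D_small_def)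
  have "digit (shrink w) = 1"
    using six_steps(7)[OF xy] w(2) by simp
  then have "digit w = 1"
    using T_map_shrink_low(2)[OF D_set_square[OF w(1)]] by (auto simp: digit_def split: if_splits)
  then have "(T_map ^^ 6) (x, y) = shrink (T_map w)"
    using return_block(1)[OF w(1)] w(2) by simp
  moreover have "(T_map ^^ (i + (6 - i))) (x, y) = (T_map ^^ 6) (x, y)"
    using assms(7) by auto
  ultimately have "(T_map ^^ (6 - i)) z \<in> D_small"
    unfolding z funpow_split using shrink_D_small[OF T_map_D_set[OF w(1)]] by simp
  then show ?thesis by (rule coveredI)
next
  case False
  let ?w = "(\<gamma>\<^sup>2 * x, \<gamma>\<^sup>2 * y)"
  have e: "\<gamma>\<^sup>2 = \<gamma> + 1" by (simp add: power2_eq_square golden_square)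
  have "(\<gamma> + 1) * (2 - \<gamma>) = 1" by (simp add: golden_simps)
  moreover have "(\<gamma> + 1) * x < (\<gamma> + 1) * (2 - \<gamma>)" "(\<gamma> + 1) * y < (\<gamma> + 1) * (2 - \<gamma>)"
    "(\<gamma> + 1) * (2 - \<gamma>) < (\<gamma> + 1) * (x + y)" "(\<gamma> + 1) * y < (\<gamma> + 1) * (\<gamma> * x)"
    "(\<gamma> + 1) * x < (\<gamma> + 1) * (\<gamma> * y)"
    using xy False golden_bounds by simp_all
  ultimately have "?w \<in> R_set - {(0, 0)}"
    using xy golden_bounds unfolding R_set_nonzero_iff e
    by (simp add: unit_square_def distrib_left mult.left_commute)
  moreover have "(x, y) = shrink ?w" by simp
  ultimately have "(x, y) \<in> D_beta" unfolding D_beta_eq by blast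
  moreover have "i \<in> {0, 1, 2}" using False assms(7) by auto
  ultimately show ?thesis unfolding covered_def z by blast
qed

text \<open>The triangle of \<open>\<D>\<close> above the line \<open>y = \<gamma>x\<close> consists of a part of \<open>\<D>/\<gamma>\<^sup>2\<close>, the pentagon \<open>D\<^sub>\<alpha>\<close>, and
  the levels \<open>1\<close> and \<open>4\<close> of \<open>tower_covered\<close>. The witnesses \<open>u, v\<close> are found by solving the formulas of
  \<open>six_steps\<close> for the starting point; the same holds in the two lemmas after this one.\<close>

lemma cover_upper:
  assumes D: "(x, y) \<in> D_set" and low: "\<gamma> * x \<le> y"
  shows "covered (x, y)"
proof -
  have sq: "(x, y) \<in> unit_square" and nz: "(x, y) \<noteq> (0, 0)"
    using D by (auto simp: D_set_iff)
  then have xy: "0 \<le> x" "x < 1" "0 \<le> y" "y < 1" by (auto simp: unit_square_def)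
  note g = golden_bounds
  have xley: "x \<le> y" using low xy g mult_right_mono[of 1 \<gamma> x] by simp
  consider "y < 2 - \<gamma>" | "(x, y) \<in> D_alpha"
    | "1 + x < \<gamma> * y" "x < 2 - \<gamma>"
    | "1 < x + y" "2 - \<gamma> \<le> x \<or> \<gamma> * y \<le> 1 + x"
  proof -
    have "(x, y) \<in> D_alpha" if "2 - \<gamma> \<le> y" "x + y \<le> 1" "\<gamma> * y \<le> 1 + x"
      using that sq low by (simp add: D_alpha_iff)
    moreover have "1 < x + y" if "1 + x < \<gamma> * y" "2 - \<gamma> \<le> x"
    proof -
      have "\<gamma> * (2 - \<gamma>) \<le> \<gamma> * x" using that(2) g by simp
      then have "\<gamma> * 1 < \<gamma> * (x + y)" using that g by (simp add: golden_simps)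
      then show ?thesis using g by simp
    qed
    ultimately show ?thesis using that by linarith
  qed
  then show ?thesis
  proof cases
    case 1
    then have "(T_map ^^ 0) (x, y) \<in> D_small"
      using xy nz low xley by (simp add: D_small_iff)
    then show ?thesis by (rule coveredI)
  next
    case 2
    then have "(x, y) = (T_map ^^ 0) (x, y)" by simp
    with 2 show ?thesis unfolding covered_def by blast
  next
    case 3
    define u where "u = 1 + (\<gamma> - 1) * x - y"
    have "(\<gamma> - 1) * (1 + x) < (\<gamma> - 1) * (\<gamma> * y)" using 3 g by simp
    then have u: "0 \<le> u" "u < 2 - \<gamma>" "x < \<gamma> * u"
      using xy g golden_mult_strict_mono[of y 1] mult_nonneg_nonneg[of "\<gamma> - 1" x]
      unfolding u_def by (simp_all add: golden_simps)
    show ?thesis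
    proof (rule tower_covered[of u x])
      show "(x, y) = (T_map ^^ 1) (u, x)"
        unfolding six_steps(1)[OF u(1,2) xy(1) 3(2) u(3)] by (simp add: u_def)
    qed (use u xy 3 in auto)
  next
    case 4
    define u v where "u = y - \<gamma> + 1" and "v = (\<gamma> - 1) * y - x"
    have "(\<gamma> - 1) * (\<gamma> * x) \<le> (\<gamma> - 1) * y" using low g by simp
    then have v0: "0 \<le> v" by (simp add: v_def golden_simps)
    have "1 < \<gamma> * y" using v0 4(1) by (simp add: v_def algebra_simps)
    then have "(\<gamma> - 1) * 1 < (\<gamma> - 1) * (\<gamma> * y)" using g by simp
    then have u: "0 \<le> u" "u < 2 - \<gamma>" "v < \<gamma> * u"
      using xy g low 4 unfolding u_def v_def by (simp_all add: golden_simps)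
    have "v < 2 - \<gamma> \<and> (u + v \<le> 2 - \<gamma> \<or> \<gamma> * v \<le> u)"
      using 4(2)
    proof
      assume *: "2 - \<gamma> \<le> x"
      have "(\<gamma> - 1) * y \<le> (\<gamma> - 1) * 1" "\<gamma> * (2 - \<gamma>) \<le> \<gamma> * x" using * xy g by simp_all
      then show ?thesis
        using * g unfolding u_def v_def by (simp add: golden_simps)
    next
      assume *: "\<gamma> * y \<le> 1 + x"
      have "(\<gamma> - 1) * ((\<gamma> - 1) * (\<gamma> * y)) \<le> (\<gamma> - 1) * ((\<gamma> - 1) * (1 + x))" using * g by simp
      moreover have "0 < x" using 4 xy by simp
      then have "0 < (\<gamma> - 1) * x" using g by simp
      ultimately show ?thesis
        using * g unfolding u_def v_def by (simp add: golden_simps)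
    qed
    then show ?thesis
    proof (intro tower_covered[of u v])
      assume v: "v < 2 - \<gamma> \<and> (u + v \<le> 2 - \<gamma> \<or> \<gamma> * v \<le> u)"
      show "(x, y) = (T_map ^^ 4) (u, v)"
        unfolding six_steps(4)[OF u(1,2) v0 conjunct1[OF v] u(3)] by (simp add: u_def v_def golden_simps)
    qed (use u v0 in auto)
  qed
qed

text \<open>The mirror image of \<open>cover_upper\<close>: reflection in the diagonal conjugates \<open>T\<close> to its inverse, and so
  it exchanges \<open>D\<^sub>\<alpha>\<close> with \<open>T(D\<^sub>\<alpha>)\<close>, \<open>T(D\<^sub>\<beta>)\<close> with \<open>T\<^sup>2(D\<^sub>\<beta>)\<close>, and the parts of the levels \<open>1\<close> and \<open>4\<close>
  over \<open>\<D>/\<gamma>\<^sup>2\<close> with those of the levels \<open>5\<close> and \<open>2\<close>.\<close>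

lemma cover_lower:
  assumes D: "(x, y) \<in> D_set" and high: "\<gamma> * y \<le> x"
  shows "covered (x, y)"
proof -
  have sq: "(x, y) \<in> unit_square" and nz: "(x, y) \<noteq> (0, 0)"
    using D by (auto simp: D_set_iff)
  then have xy: "0 \<le> x" "x < 1" "0 \<le> y" "y < 1" by (auto simp: unit_square_def)
  note g = golden_bounds
  have ylex: "y \<le> x" using high xy g mult_right_mono[of 1 \<gamma> y] by simp
  have red: "y \<le> (\<gamma> - 1) * x"
  proof -
    have "(\<gamma> - 1) * (\<gamma> * y) \<le> (\<gamma> - 1) * x" using high g by simp
    then show ?thesis by (simp add: golden_simps)
  qed
  consider "x < 2 - \<gamma>"
    | "2 - \<gamma> \<le> x" "x + y \<le> 1" "\<gamma> * x \<le> 1 + y"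
    | "1 + y < \<gamma> * x" "y < 2 - \<gamma>" "x + y \<le> 1 \<or> \<gamma> * y \<le> x - \<gamma> + 1"
    | "1 < x + y" "x - \<gamma> * y < \<gamma> - 1 \<or> \<gamma> * x \<le> 1 + y"
  proof -
    have "\<gamma> * (2 - \<gamma>) = \<gamma> - 1" "2 - \<gamma> \<le> y \<Longrightarrow> \<gamma> * (2 - \<gamma>) \<le> \<gamma> * y"
      "2 - \<gamma> \<le> y \<Longrightarrow> x + y \<le> 1 \<Longrightarrow> \<gamma> * x \<le> \<gamma> * (\<gamma> - 1)"
      using golden_mult_mono[of "2 - \<gamma>" y] golden_mult_mono[of x "\<gamma> - 1"] by (simp_all add: golden_simps)
    moreover have "\<gamma> * (\<gamma> - 1) = 1" by (simp add: golden_simps)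
    ultimately show ?thesis using that xy g by linarith
  qed
  then show ?thesis
  proof cases
    case 1
    then have "(T_map ^^ 0) (x, y) \<in> D_small"
      using xy nz high ylex by (simp add: D_small_iff)
    then show ?thesis by (rule coveredI)
  next
    case 2
    define u where "u = (\<gamma> - 1) * x - y"
    have "u \<le> x"
      using mult_right_mono[of "\<gamma> - 1" 1 x] xy g unfolding u_def by linarith
    moreover have "0 \<le> \<gamma> * y" using xy g by simp
    then have "\<gamma> * u \<le> x" "u + x \<le> 1" "\<gamma> * x \<le> 1 + u"
      using 2 xy g red unfolding u_def by (simp_all add: golden_simps)
    ultimately have "(u, x) \<in> D_alpha"
      using 2 xy red by (simp add: D_alpha_iff unit_square_def u_def)
    moreover from this have "(x, y) = (T_map ^^ 1) (u, x)"
      by (simp add: D_alpha_second_iterate(1) u_def)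
    ultimately show ?thesis unfolding covered_def by blast
  next
    case 3
    define u where "u = x - \<gamma> + 1"
    have "(\<gamma> - 1) * (1 + y) < (\<gamma> - 1) * (\<gamma> * x)" using 3(1) g by simp
    moreover have "0 \<le> (\<gamma> - 1) * y" using xy g by simp
    ultimately have u: "0 \<le> u" "u < 2 - \<gamma>" "y < \<gamma> * u" "u + y \<le> 2 - \<gamma> \<or> \<gamma> * y \<le> u"
      using 3 xy g unfolding u_def by (auto simp: golden_simps)
    show ?thesis
    proof (rule tower_covered[of u y])
      show "(x, y) = (T_map ^^ 5) (u, y)"
        unfolding six_steps(5)[OF u(1,2) xy(3) 3(2) u(3)] by (simp add: u_def)
    qed (use u xy 3 in auto)
  next
    case 4
    define u v where "u = 1 - (\<gamma> - 1) * (x + y)" and "v = (\<gamma> - 1) * x - y"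
    have v0: "0 \<le> v" using red by (simp add: v_def)
    have "(\<gamma> - 1) * x \<le> (\<gamma> - 1) * 1" "\<gamma> * x < \<gamma> * 1" "(\<gamma> - 1) * y \<le> (\<gamma> - 1) * ((\<gamma> - 1) * x)"
      "(\<gamma> - 1) * 1 < (\<gamma> - 1) * (x + y)"
      using xy g red 4(1) by simp_all
    then have u: "0 \<le> u" "u < 2 - \<gamma>" "v < \<gamma> * u"
      using xy g unfolding u_def v_def by (simp_all add: golden_simps)
    have v: "v < 2 - \<gamma>"
      using 4(2)
    proof
      assume "x - \<gamma> * y < \<gamma> - 1"
      then have "(\<gamma> - 1) * (x - \<gamma> * y) < (\<gamma> - 1) * (\<gamma> - 1)" using g by simp
      then show ?thesis unfolding v_def by (simp add: golden_simps)
    next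
      assume *: "\<gamma> * x \<le> 1 + y"
      have "(\<gamma> - 1) * ((\<gamma> - 1) * (\<gamma> * x)) \<le> (\<gamma> - 1) * ((\<gamma> - 1) * (1 + y))" using * g by simp
      moreover have "0 < (\<gamma> - 1) * y" using 4 xy g by simp
      ultimately show ?thesis unfolding v_def by (simp add: golden_simps)
    qed
    show ?thesis
    proof (rule tower_covered[of u v])
      show "(x, y) = (T_map ^^ 2) (u, v)"
        unfolding six_steps(2)[OF u(1,2) v0 v u(3)] by (simp add: u_def v_def golden_simps)
    qed (use u v v0 in auto)
  qed
qed

text \<open>In the triangle between the lines \<open>y = \<gamma>x\<close> and \<open>x = \<gamma>y\<close> below \<open>\<R>\<close>, points with both coordinates
  less than \<open>1/\<gamma>\<^sup>2\<close> are in \<open>\<D>/\<gamma>\<^sup>2\<close> or \<open>D\<^sub>\<beta>\<close>, and the others belong to level \<open>3\<close>.\<close>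

lemma cover_middle:
  assumes D: "(x, y) \<in> D_set" and mid: "y < \<gamma> * x" "x < \<gamma> * y"
  shows "covered (x, y)"
proof -
  have xy: "0 \<le> x" "x < 1" "0 \<le> y" "y < 1" and sum: "x + y \<le> 1"
    using D mid by (auto simp: D_set_iff unit_square_def)
  note g = golden_bounds
  show ?thesis
  proof (cases "x < 2 - \<gamma> \<and> y < 2 - \<gamma>")
    case True
    then show ?thesis
      using tower_covered[of x y "(x, y)" 0] xy mid by simp
  next
    case False
    define u v where "u = 2 - \<gamma> - x + (\<gamma> - 1) * y" and "v = (\<gamma> - 1) * (1 - x - y)"
    have pos: "0 < x" "0 < y"
      using mid xy g by (auto simp: less_le)
    then have far: "2 - \<gamma> < x + y" using False by linarith
    have "(\<gamma> - 1) * x < (\<gamma> - 1) * (\<gamma> * y)" "(\<gamma> - 1) * (x - \<gamma> * y) \<le> (\<gamma> - 1) * 0"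
      "(\<gamma> - 1) * y < (\<gamma> - 1) * (\<gamma> * x)" "(\<gamma> - 1) * ((\<gamma> - 1) * (x + y)) \<le> (\<gamma> - 1) * ((\<gamma> - 1) * 1)"
      "0 \<le> (\<gamma> - 1) * (1 - x - y)" "(\<gamma> - 1) * (2 - \<gamma>) < (\<gamma> - 1) * (x + y)"
      using mid sum g far by (simp_all add: mult_le_0_iff)
    moreover have "2 - \<gamma> \<le> x \<Longrightarrow> \<gamma> * (2 - \<gamma>) \<le> \<gamma> * x" "2 - \<gamma> \<le> y \<Longrightarrow> \<gamma> * (2 - \<gamma>) \<le> \<gamma> * y"
      using g by simp_all
    ultimately have uv: "0 \<le> u" "u < 2 - \<gamma>" "0 \<le> v" "v < 2 - \<gamma>" "v < \<gamma> * u"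
      "u + v \<le> 2 - \<gamma> \<or> \<gamma> * v \<le> u"
      using mid False g unfolding u_def v_def by (auto simp: golden_simps)
    show ?thesis
    proof (rule tower_covered[of u v])
      show "(x, y) = (T_map ^^ 3) (u, v)"
        unfolding six_steps(3)[OF uv(1-5)] by (simp add: u_def v_def golden_simps)
    qed (use uv in auto)
  qed
qed

lemma P_set_cases:
  assumes "z \<in> P_set"
  shows "(\<exists>m \<in> {0, 1}. \<exists>w \<in> D_alpha. z = (T_map ^^ m) w)
     \<or> (\<exists>m \<in> {0, 1, 2}. \<exists>w \<in> D_beta. z = (T_map ^^ m) w)"
proof -
  obtain x y where z: "z = (x, y)" by fastforce
  have D: "(x, y) \<in> D_set" using assms by (simp add: P_set_def z)
  have "covered (x, y)"
    using cover_upper[OF D] cover_lower[OF D] cover_middle[OF D] by linarith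
  then show ?thesis
    using assms unfolding covered_def P_set_def z by blast
qed

section \<open>Periods of the points whose \<open>S\<close>-iteration stops\<close>

lemma T_period_alpha:
  assumes S: "S_iter n z = Some ((T_map ^^ m) w)" and w: "w \<in> D_alpha"
  shows "T_period z = enat ((if w = z_alpha then 1 else 5) * ((5 * 4 ^ n + 1) div 3))"
proof -
  obtain l where l: "4 ^ n = 3 * l + (1::nat)"
    by (rule power_four_decomposition)
  define k :: nat where "k = (if w = z_alpha then 1 else 5)"
  have "w \<in> unit_square" using w by (auto simp: D_alpha_def)
  then have "cycle_with (2 * k) k ((T_map ^^ m) w)"
    using cycle_D_alpha[OF w] by (auto simp: cycle_shift k_def)
  from cycle_S_iter[OF S this l] have "T_period z = enat (2 * k + 5 * k * l)"
    by (rule T_period_cycle)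
  also have "2 * k + 5 * k * l = k * ((5 * 4 ^ n + 1) div 3)"
    unfolding l by (simp add: algebra_simps)
  finally show ?thesis by (simp add: k_def)
qed

lemma T_period_beta:
  assumes S: "S_iter n z = Some ((T_map ^^ m) w)" and w: "w \<in> D_beta"
  shows "T_period z = enat ((if w = z_beta then 1 else 5) * ((10 * 4 ^ n - 1) div 3))"
proof -
  obtain l where l: "4 ^ n = 3 * l + (1::nat)"
    by (rule power_four_decomposition)
  define k :: nat where "k = (if w = z_beta then 1 else 5)"
  have "w \<in> unit_square"
    using w D_beta_third_iterate(5) unfolding D_beta_eq by blast
  then have "cycle_with (3 * k) (2 * k) ((T_map ^^ m) w)"
    using cycle_D_beta[OF w] by (auto simp: cycle_shift k_def)
  from cycle_S_iter[OF S this l] have "T_period z = enat (3 * k + 5 * (2 * k) * l)"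
    by (rule T_period_cycle)
  also have "3 * k + 5 * (2 * k) * l = k * ((10 * 4 ^ n - 1) div 3)"
  proof -
    have "10 * 4 ^ n - 1 = 3 * (10 * l + (3::nat))" unfolding l by simp
    then show ?thesis by (simp add: algebra_simps)
  qed
  finally show ?thesis by (simp add: k_def)
qed

lemma z_alpha_in_D_alpha: "z_alpha \<in> D_alpha"
proof -
  have "0 < \<gamma> + 2" using golden_bounds by simp
  then show ?thesis
    using golden_bounds unfolding z_alpha_coordinates D_alpha_iff
    by (simp add: unit_square_def pos_divide_less_eq pos_le_divide_eq pos_divide_le_eq
        add_divide_distrib[symmetric] divide_right_mono golden_square field_simps)
qed

lemma z_beta_in_D_beta: "z_beta \<in> D_beta"
  unfolding z_beta_eq D_beta_eq using z_R_in_R_set by (rule imageI)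

lemma T_period_fixed:
  assumes "T_map z = z"
  shows "T_period z = 1"
proof -
  have "cycle_with 1 (ones 1 z) z"
    by (rule cycle_by_prime_divisors) (use assms in auto)
  then show ?thesis using T_period_cycle by (simp add: one_enat_def)
qed

section \<open>Integer sequences\<close>

context
  fixes a :: "int \<Rightarrow> int"
  assumes bounds: "\<And>k. 0 \<le> of_int (a (k - 1)) + \<gamma> * of_int (a k) + of_int (a (k + 1))"
    "\<And>k. of_int (a (k - 1)) + \<gamma> * of_int (a k) + of_int (a (k + 1)) < 1"
begin

lemma frac_sequence:
  "frac (\<gamma> * of_int (a k)) = of_int (a (k - 1)) + \<gamma> * of_int (a k) + of_int (a (k + 1))"
proof -
  have "\<gamma> * of_int (a k) - (of_int (a (k - 1)) + \<gamma> * of_int (a k) + of_int (a (k + 1)))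
      = of_int (- a (k - 1) - a (k + 1))" by simp
  then show ?thesis
    using bounds[of k] unfolding frac_unique_iff by (metis Ints_of_int)
qed

lemma sequence_recurrence: "a (k - 1) + a (k + 1) = - \<lfloor>\<gamma> * of_int (a k)\<rfloor>"
proof -
  have "of_int (a (k - 1) + a (k + 1)) = (of_int (- \<lfloor>\<gamma> * of_int (a k)\<rfloor>) :: real)"
    using frac_sequence[of k] by (simp add: frac_def)
  then show ?thesis by (simp only: of_int_eq_iff)
qed

text \<open>Put \<open>x\<^sub>k = {\<gamma>a\<^sub>k}\<close>. By \<open>frac_sequence\<close>, both \<open>-x\<^bsub>k-1\<^esub> + x\<^sub>k/\<gamma>\<close> and \<open>x\<^bsub>k+1\<^esub>\<close> are integer combinations of \<open>1\<close>
  and \<open>\<gamma>\<close>, and the multiples of \<open>\<gamma>\<close> agree, so they differ by an integer.\<close>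

lemma T_map_sequence:
  "T_map (frac (\<gamma> * of_int (a (k - 1))), frac (\<gamma> * of_int (a k)))
     = (frac (\<gamma> * of_int (a k)), frac (\<gamma> * of_int (a (k + 1))))"
proof -
  let ?x = "\<lambda>k. frac (\<gamma> * of_int (a k))"
  have "?x k / \<gamma> = (\<gamma> - 1) * ?x k"
    using golden_inverse(1) by (metis mult.commute mult_1 times_divide_eq_right)
  then have "- ?x (k - 1) + ?x k / \<gamma> - ?x (k + 1)
      = of_int (- a (k - 2) - a (k - 1) - a k - a (k + 1) - a (k + 2))"
    unfolding frac_sequence by (simp add: golden_simps)
  then have "frac (- ?x (k - 1) + ?x k / \<gamma>) = ?x (k + 1)"
    unfolding frac_unique_iff by (metis Ints_of_int frac_ge_0 frac_lt_1)
  then show ?thesis by (simp add: T_map_def)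
qed

lemma funpow_sequence:
  "(T_map ^^ p) (frac (\<gamma> * of_int (a (k - 1))), frac (\<gamma> * of_int (a k)))
     = (frac (\<gamma> * of_int (a (k - 1 + int p))), frac (\<gamma> * of_int (a (k + int p))))"
proof (induction p)
  case (Suc p)
  then show ?case
    using T_map_sequence[of "k + int p"] by (simp add: algebra_simps)
qed simp

text \<open>As \<open>\<gamma>\<close> is irrational, equal fractional parts of \<open>\<gamma>i\<close> and \<open>\<gamma>j\<close> force \<open>i = j\<close>. A period of the point
  thus repeats two consecutive terms of the sequence, and the recurrence spreads this in both
  directions.\<close>

lemma seq_period_eq_T_period:
  "seq_period a = T_period (frac (\<gamma> * of_int (a (k - 1))), frac (\<gamma> * of_int (a k)))"
proof -
  have inj: "i = j" if eq: "frac (\<gamma> * of_int i) = frac (\<gamma> * of_int j)" for i j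
  proof -
    have "\<gamma> * of_int (i - j) = of_int (\<lfloor>\<gamma> * of_int i\<rfloor> - \<lfloor>\<gamma> * of_int j\<rfloor>)"
      using eq by (simp add: frac_def algebra_simps)
    then show ?thesis using golden_irrational by fastforce
  qed
  have "(T_map ^^ p) (frac (\<gamma> * of_int (a (k - 1))), frac (\<gamma> * of_int (a k)))
      = (frac (\<gamma> * of_int (a (k - 1))), frac (\<gamma> * of_int (a k)))
    \<longleftrightarrow> (\<forall>j. a (j + int p) = a j)" (is "?fixed \<longleftrightarrow> ?periodic") for p
  proof
    assume ?fixed
    then have start: "a (k - 1 + int p) = a (k - 1)" "a (k + int p) = a k"
      unfolding funpow_sequence by (auto dest!: inj)
    have rec: "a (j - 1 + int p) + a (j + 1 + int p) = - \<lfloor>\<gamma> * of_int (a (j + int p))\<rfloor>" for j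
      using sequence_recurrence[of "j + int p"] by (simp add: algebra_simps)
    have "a (j - 1 + int p) = a (j - 1) \<and> a (j + int p) = a j" for j
    proof (induction j rule: int_induct[of _ k])
      case (step1 j)
      then show ?case using rec[of j] sequence_recurrence[of j] by simp
    next
      case (step2 j)
      then show ?case using rec[of "j - 1"] sequence_recurrence[of "j - 1"] by simp
    qed (use start in blast)
    then show ?periodic by blast
  next
    assume ?periodic
    then show ?fixed unfolding funpow_sequence by simp
  qed
  then show ?thesis by (simp add: seq_period_def T_period_def)
qed

end

section \<open>The classification of periods\<close>

theorem theorem2p3:
  shows "(\<forall>z \<in> unit_square.
      (z = (0, 0) \<or> z = z_R \<longrightarrow> T_period z = 1)
    \<and> (z \<in> R_set - {(0, 0), z_R} \<longrightarrow> T_period z = 5)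
    \<and> (\<forall>n. \<forall>m \<in> {0, 1}. S_iter n z = Some ((T_map ^^ m) z_alpha)
          \<longrightarrow> T_period z = enat ((5 * 4 ^ n + 1) div 3))
    \<and> (\<forall>n. \<forall>m \<in> {0, 1}. S_iter_in n z ((T_map ^^ m) ` (D_alpha - {z_alpha}))
          \<longrightarrow> T_period z = enat (5 * ((5 * 4 ^ n + 1) div 3)))
    \<and> (\<forall>n. \<forall>m \<in> {0, 1, 2}. S_iter n z = Some ((T_map ^^ m) z_beta)
          \<longrightarrow> T_period z = enat ((10 * 4 ^ n - 1) div 3))
    \<and> (\<forall>n. \<forall>m \<in> {0, 1, 2}. S_iter_in n z ((T_map ^^ m) ` (D_beta - {z_beta}))
          \<longrightarrow> T_period z = enat (5 * ((10 * 4 ^ n - 1) div 3)))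
    \<and> ((\<forall>n. S_iter_in n z (D_set - P_set)) \<longrightarrow> T_period z = \<infinity>)
    \<and> (z = (0, 0) \<or> z = z_R
        \<or> z \<in> R_set - {(0, 0), z_R}
        \<or> (\<exists>n. \<exists>m \<in> {0, 1}. S_iter n z = Some ((T_map ^^ m) z_alpha))
        \<or> (\<exists>n. \<exists>m \<in> {0, 1}. S_iter_in n z ((T_map ^^ m) ` (D_alpha - {z_alpha})))
        \<or> (\<exists>n. \<exists>m \<in> {0, 1, 2}. S_iter n z = Some ((T_map ^^ m) z_beta))
        \<or> (\<exists>n. \<exists>m \<in> {0, 1, 2}. S_iter_in n z ((T_map ^^ m) ` (D_beta - {z_beta})))
        \<or> (\<forall>n. S_iter_in n z (D_set - P_set))))
  \<and> (\<forall>a :: int \<Rightarrow> int.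
      (\<forall>k. 0 \<le> of_int (a (k - 1)) + golden * of_int (a k) + of_int (a (k + 1))
         \<and> of_int (a (k - 1)) + golden * of_int (a k) + of_int (a (k + 1)) < 1)
      \<longrightarrow> (\<forall>k. seq_period a
                = T_period (frac (golden * of_int (a (k - 1))), frac (golden * of_int (a k)))))"
proof (intro conjI ballI allI impI)
  fix z :: "real \<times> real" assume z: "z \<in> unit_square"
  show "T_period z = 1" if "z = (0, 0) \<or> z = z_R"
  proof (rule T_period_fixed)
    have "T_map (0, 0) = (0, 0)" by (simp add: T_map_def)
    moreover have "T_map z_R = z_R" using R_set_fixed_iff[OF z_R_in_R_set] by simp
    ultimately show "T_map z = z" using that by blast
  qed
  show "T_period z = 5" if "z \<in> R_set - {(0, 0), z_R}"
    using cycle_R_set[OF that] T_period_cycle by (metis numeral_eq_enat)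
  show "T_period z = \<infinity>" if "\<forall>n. S_iter_in n z (D_set - P_set)"
    using not_periodic that by blast
  show "T_period z = enat ((5 * 4 ^ n + 1) div 3)" if "S_iter n z = Some ((T_map ^^ m) z_alpha)" for n m
    using T_period_alpha[OF that z_alpha_in_D_alpha] by simp
  show "T_period z = enat ((10 * 4 ^ n - 1) div 3)" if "S_iter n z = Some ((T_map ^^ m) z_beta)" for n m
    using T_period_beta[OF that z_beta_in_D_beta] by simp
  show "T_period z = enat (5 * ((5 * 4 ^ n + 1) div 3))"
    if in_alpha: "S_iter_in n z ((T_map ^^ m) ` (D_alpha - {z_alpha}))" for n m
  proof -
    obtain w where "w \<in> D_alpha" "w \<noteq> z_alpha" "S_iter n z = Some ((T_map ^^ m) w)"
      using in_alpha unfolding S_iter_in_def by blast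
    then show ?thesis using T_period_alpha by simp
  qed
  show "T_period z = enat (5 * ((10 * 4 ^ n - 1) div 3))"
    if in_beta: "S_iter_in n z ((T_map ^^ m) ` (D_beta - {z_beta}))" for n m
  proof -
    obtain w where "w \<in> D_beta" "w \<noteq> z_beta" "S_iter n z = Some ((T_map ^^ m) w)"
      using in_beta unfolding S_iter_in_def by blast
    then show ?thesis using T_period_beta by simp
  qed
  show "z = (0, 0) \<or> z = z_R
      \<or> z \<in> R_set - {(0, 0), z_R}
      \<or> (\<exists>n. \<exists>m \<in> {0, 1}. S_iter n z = Some ((T_map ^^ m) z_alpha))
      \<or> (\<exists>n. \<exists>m \<in> {0, 1}. S_iter_in n z ((T_map ^^ m) ` (D_alpha - {z_alpha})))
      \<or> (\<exists>n. \<exists>m \<in> {0, 1, 2}. S_iter n z = Some ((T_map ^^ m) z_beta))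
      \<or> (\<exists>n. \<exists>m \<in> {0, 1, 2}. S_iter_in n z ((T_map ^^ m) ` (D_beta - {z_beta})))
      \<or> (\<forall>n. S_iter_in n z (D_set - P_set))" (is "_ \<or> _ \<or> _ \<or> ?rest")
  proof -
    have ?rest if D: "z \<in> D_set" "\<not> (\<forall>n. S_iter_in n z (D_set - P_set))"
    proof -
      obtain n w where n: "w \<in> P_set" "S_iter n z = Some w"
        using S_iter_dichotomy[OF D] by blast
      from P_set_cases[OF n(1)] show ?thesis
      proof
        assume "\<exists>m \<in> {0, 1}. \<exists>v \<in> D_alpha. w = (T_map ^^ m) v"
        then obtain m v where m: "m \<in> {0, 1}" "v \<in> D_alpha" "w = (T_map ^^ m) v" by blast
        show ?thesis
        proof (cases "v = z_alpha")
          case True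
          then show ?thesis using m n(2) by blast
        next
          case False
          then have "S_iter_in n z ((T_map ^^ m) ` (D_alpha - {z_alpha}))"
            using m n(2) unfolding S_iter_in_def by blast
          then show ?thesis using m(1) by blast
        qed
      next
        assume "\<exists>m \<in> {0, 1, 2}. \<exists>v \<in> D_beta. w = (T_map ^^ m) v"
        then obtain m v where m: "m \<in> {0, 1, 2}" "v \<in> D_beta" "w = (T_map ^^ m) v" by blast
        show ?thesis
        proof (cases "v = z_beta")
          case True
          then show ?thesis using m n(2) by blast
        next
          case False
          then have "S_iter_in n z ((T_map ^^ m) ` (D_beta - {z_beta}))"
            using m n(2) unfolding S_iter_in_def by blast
          then show ?thesis using m(1) by blast
        qed
      qed
    qed
    then show ?thesis using z unfolding D_set_def by blast
  qed
next
  fix a :: "int \<Rightarrow> int" and k :: int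
  assume "\<forall>k. 0 \<le> of_int (a (k - 1)) + \<gamma> * of_int (a k) + of_int (a (k + 1))
         \<and> of_int (a (k - 1)) + \<gamma> * of_int (a k) + of_int (a (k + 1)) < 1"
  then show "seq_period a = T_period (frac (\<gamma> * of_int (a (k - 1))), frac (\<gamma> * of_int (a k)))"
    using seq_period_eq_T_period[of a k] by blast
qed

end
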